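(* Let $\Omega\subseteq\mathbb{R}^d$ be a bounded region of interest and let $\{g_N\}_{N=1}^{\infty}$ be either a sequence of uniformly admissible plane reference waves on $\{\Xi^{\mathrm{pl}}_{\Omega,N}\}_{N=1}^\infty$, or a sequence of uniformly admissible spherical reference waves on $\{\Xi^{\mathrm{sph}}_{\Omega,N}\}_{N=1}^\infty$ (in the spherical case with $\mathbf 0\notin\Lambda_{\Omega,N}$ for every $N\ge 1$). Let $s>d/2$ and let $\phi\in H^{s}(\mathbb{R}^{d})$ be a nonnegative refinable function with $\operatorname{supp}(\phi)\subseteq[0,M_1]\times\cdots\times[0,M_d]$, whose Sobolev smoothness exponent satisfies $\nu_{2}(\phi)>\varsigma>s$ and whose sum rule order satisfies $\mathrm{sr}_{\phi}>\varsigma$. Then for any $f\in H^{\varsigma}(\mathbb{R}^{d})$, $$\Big\|f|_{\Omega}-S_{N}f|_{\Omega}\Big\|_{L^2(\mathbb{R}^d)}=O(2^{-N\alpha/2})\quad (N\to\infty),\qquad \alpha=\min\{1,\varsigma-s\},$$ where $S_Nf=\sum_{\mathbf k\in\Lambda_{\Omega,N}}\mathring f(2^{-N}\mathbf k)\,\phi(2^N\cdot-\mathbf k)$ is built from $\phi$ and from the measurements of the single-shot intensity $I_N(\mathbf x)=|f(\mathbf x)+g_N(\mathbf x)|^2$ on the finite set of points $2^{-N}\mathbf k,2^{-N}\mathbf k',2^{-N}\mathbf k''$ with $(\mathbf k,\mathbf k',\mathbf k'')\in\Xi_{\Omega,N}$ (here $\Xi_{\Omega,N}$ is $\Xi^{\mathrm{pl}}_{\Omega,N}$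 in the plane case and $\Xi^{\mathrm{sph}}_{\Omega,N}$ in the spherical case).
   Context: **Sobolev spaces.** $\widehat f(\xi)=\int_{\mathbb R^d}f(\mathbf x)e^{-\mathbf i\mathbf x\cdot\xi}d\mathbf x$; $H^{s}(\mathbb R^d)$ is the space of $f:\mathbb R^d\to\mathbb C$ with $\int|\widehat f(\xi)|^2(1+\|\xi\|_2^2)^sd\xi<\infty$; $\nu_2(f)=\sup\{s\in\mathbb R:f\in H^s(\mathbb R^d)\}$. For $s>d/2$ functions in $H^s(\mathbb R^d)$ are identified with their continuous representatives. $f|_\Omega$ is the restriction of $f$ to $\Omega$ (its $L^2$ norm is computed over $\Omega$). **Refinable functions.** $\phi$ is refinable if $\widehat\phi(2\xi)=\widehat a(\xi)\widehat\phi(\xi)$ for a $2\pi\mathbb Z^d$-periodic function $\widehat a$ (the mask symbol), normalized by $\widehat\phi(\mathbf 0)=1$. The mask symbol has $\kappa+1$ sum rules if $\widehat a(\xi+2\pi\gamma)=O(\|\xi\|_2^{\kappa+1})$ as $\xi\to\mathbf 0$ for every representative $\gamma$ of a nonzero coset of $[2^{-1}\mathbb Z^d]/\mathbb Z^d$; then one says the sum rule order $\mathrm{sr}_\phi$ of $\phi$ is $\kappa+1$. **Index sets.** $\Omega$ is bounded and $\mathbb Z_\Omega^d:=\Omega\cap\mathbb Z^d\ne\emptyset$. $L_{l,\min}=\min\{k_l:(k_1,\dots,k_d)\in\mathbb Z^d_\Omega\}$, $L_{l,\max}=\max\{k_l:(k_1,\dots,k_d)\in\mathbb Z^d_\Omega\}$,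 and $\Lambda_{\Omega,N}=\{(k_1,\dots,k_d)\in\mathbb Z^d:2^NL_{l,\min}-M_l\le k_l\le2^NL_{l,\max},\ l=1,\dots,d\}$, with $M_l>0$. For a fixed $j_0\in\{1,\dots,d\}$ and standard basis vector $\mathbf e_{j_0}$: $\Xi^{\mathrm{pl}}_{\Omega,N}=\{(\mathbf k,\mathbf k+\mathbf e_{j_0},\mathbf k-\mathbf e_{j_0}):\mathbf k\in\Lambda_{\Omega,N}\}$. Also $\Xi^{\mathrm{sph}}_{\Omega,N}=\{(\mathbf k,(1+2^{-N})\mathbf k,(1-2^{-N})\mathbf k):\mathbf k\in\Lambda_{\Omega,N}\}$. Elements are written $(\mathbf k,\mathbf k',\mathbf k'')$. **Reference waves.** A plane wave is $g(\mathbf x)=ae^{\mathbf i\mathcal K\cdot\mathbf x}$ with $a>0$, $\mathcal K\in\mathbb R^d$; a spherical wave is $g(\mathbf x)=\frac{b}{\|\mathbf x\|_2}e^{\mathbf i\nu\|\mathbf x\|_2}$ on $\mathbb R^d\setminus\{\mathbf 0\}$ with $b>0$, $\nu\in\mathbb R\setminus\{0\}$. **Admissibility.** $g_N$ is $\gamma$-admissible ($0<\gamma<\infty$) on $\Xi_{\Omega,N}$ w.r.t. level $N$ if (i) for all $(\mathbf k,\mathbf k',\mathbf k'')\in\Xi_{\Omega,N}$, $g_N(2^{-N}\mathbf k)\ne g_N(2^{-N}\mathbf k')$ and $g_N(2^{-N}\mathbf k)\ne g_N(2^{-N}\mathbf k'')$; and (ii) $$\max_{(\mathbf k,\mathbf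 k',\mathbf k'')\in\Xi_{\Omega,N}}\frac{\max\{|g_N(2^{-N}\mathbf k)-g_N(2^{-N}\mathbf k')|,\ |\overline{g_N}(2^{-N}\mathbf k)-\overline{g_N}(2^{-N}\mathbf k'')|\}}{|\Im[(g_N(2^{-N}\mathbf k)-g_N(2^{-N}\mathbf k'))(\overline{g_N}(2^{-N}\mathbf k)-\overline{g_N}(2^{-N}\mathbf k''))]|}\le\gamma$$ (the quotient being $+\infty$ if its denominator is $0$). A sequence $\{g_N\}_{N\ge1}$ is uniformly $\gamma$-admissible on $\{\Xi_{\Omega,N}\}_{N\ge1}$ if every $g_N$ is $\gamma$-admissible on $\Xi_{\Omega,N}$ w.r.t. level $N$ (same $\gamma$) and $\sup_{N\ge1}\sup_{(\mathbf k,\mathbf k',\mathbf k'')\in\Xi_{\Omega,N}}\{|g_N(2^{-N}\mathbf k)|,|g_N(2^{-N}\mathbf k')|,|g_N(2^{-N}\mathbf k'')|\}<\infty$. Uniformly admissible means uniformly $\gamma$-admissible for some $\gamma\in(0,\infty)$. **Reconstructed samples.** For $\mathbf k\in\Lambda_{\Omega,N}$ with triple $(\mathbf k,\mathbf k',\mathbf k'')\in\Xi_{\Omega,N}$, put $I_{N,\mathbf m}=|f(2^{-N}\mathbf m)+g_N(2^{-N}\mathbf m)|^2$ for $\mathbf m\in\{\mathbf k,\mathbf k',\mathbf k''\}$, $c+\mathbf i\,\delta=g_N(2^{-N}\mathbf k)-g_N(2^{-N}\mathbf k')$, $h+\mathbf i\,e=g_N(2^{-N}\mathbf k)-g_N(2^{-N}\mathbf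 k'')$ with $c,\delta,h,e$ real, and $\mu=ce-\delta h=-\Im[(g_N(2^{-N}\mathbf k)-g_N(2^{-N}\mathbf k'))(\overline{g_N}(2^{-N}\mathbf k)-\overline{g_N}(2^{-N}\mathbf k''))]$ (nonzero by admissibility). Then $\mathring f(2^{-N}\mathbf k)=u+\mathbf i v$ where $$\begin{bmatrix} u \\ v \end{bmatrix}=\frac{1}{2\mu}\begin{bmatrix} e & -\delta \\ -h & c \end{bmatrix}\begin{bmatrix} I_{N,\mathbf k}-I_{N,\mathbf k'}+|g_N(2^{-N}\mathbf k')|^2-|g_N(2^{-N}\mathbf k)|^2 \\ I_{N,\mathbf k}-I_{N,\mathbf k''}+|g_N(2^{-N}\mathbf k'')|^2-|g_N(2^{-N}\mathbf k)|^2 \end{bmatrix}.$$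
   Formalization: The formal theorem additionally assumes that, up to a null set, Ω lies in the box spanned by the extreme coordinates L_min, L_max of its integer points; otherwise S_N f vanishes for large N on the part outside and the claim fails. *)

theory Defs
  imports "HOL-Analysis.Analysis" "HOL-Library.Landau_Symbols"
begin

subsection \<open>Fourier transform and Sobolev spaces\<close>

text \<open>The integral is only meaningful for integrable \<open>f\<close>; for square-integrable functions use
  \<open>has_fourier_L2\<close> below.\<close>

definition fourier :: "(real ^ 'n \<Rightarrow> complex) \<Rightarrow> real ^ 'n \<Rightarrow> complex" where
  "fourier f \<xi> = (LINT x|lborel. f x * exp (- \<i> * complex_of_real (x \<bullet> \<xi>)))"

definition square_integrable :: "(real ^ 'n \<Rightarrow> complex) \<Rightarrow> bool" where
  "square_integrable f \<longleftrightarrow>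
     f \<in> borel_measurable lborel \<and> integrable lborel (\<lambda>x. (cmod (f x))\<^sup>2)"

definition L2_converges ::
    "(nat \<Rightarrow> real ^ 'n \<Rightarrow> complex) \<Rightarrow> (real ^ 'n \<Rightarrow> complex) \<Rightarrow> bool" where
  "L2_converges h f \<longleftrightarrow>
     ((\<lambda>n. \<integral>\<^sup>+ x. ennreal ((cmod (h n x - f x))\<^sup>2) \<partial>lborel) \<longlonglongrightarrow> 0)"

text \<open>The Fourier transform on \<open>L\<^sup>2\<close> is the continuous extension of the Fourier integral
  from \<open>L\<^sup>1 \<inter> L\<^sup>2\<close>. It is determined only almost everywhere, so it is rendered as a relation.\<close>

definition has_fourier_L2 :: "(real ^ 'n \<Rightarrow> complex) \<Rightarrow> (real ^ 'n \<Rightarrow> complex) \<Rightarrow> bool" where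
  "has_fourier_L2 f F \<longleftrightarrow> square_integrable f \<and> square_integrable F \<and>
     (\<exists>h. (\<forall>n. integrable lborel (h n) \<and> square_integrable (h n)) \<and>
          L2_converges h f \<and> L2_converges (\<lambda>n. fourier (h n)) F)"

text \<open>For \<open>s \<ge> 0\<close> every element of \<open>H\<^sup>s\<close> is in \<open>L\<^sup>2\<close>, so this is the usual space. For \<open>s < 0\<close> it
  is the intersection of the usual space with \<open>L\<^sup>2\<close>, which does not affect
  \<open>sobolev_exponent f\<close> for \<open>f\<close> in \<open>L\<^sup>2\<close>. Elements are functions, not equivalence classes.\<close>

definition sobolev :: "real \<Rightarrow> (real ^ 'n \<Rightarrow> complex) set" where
  "sobolev s = {f. \<exists>F. has_fourier_L2 f F \<and>
     integrable lborel (\<lambda>\<xi>. (cmod (F \<xi>))\<^sup>2 * (1 + (norm \<xi>)\<^sup>2) powr s)}"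

text \<open>The supremum is taken in the extended reals, as it may be infinite.\<close>

definition sobolev_exponent :: "(real ^ 'n \<Rightarrow> complex) \<Rightarrow> ereal" where
  "sobolev_exponent f = Sup {ereal s | s. f \<in> sobolev s}"

definition L2_norm_on :: "(real ^ 'n) set \<Rightarrow> (real ^ 'n \<Rightarrow> complex) \<Rightarrow> real" where
  "L2_norm_on \<Omega> h = sqrt (LINT x:\<Omega>|lebesgue. (cmod (h x))\<^sup>2)"


subsection \<open>Refinable functions\<close>

definition integer_points :: "(real ^ 'n) set" where
  "integer_points = {k. \<forall>l. k $ l \<in> \<int>}"

text \<open>Refinable functions are used here only when they are integrable, so the Fourier integral is
  the right transform. The mask symbol \<open>a\<close> is a parameter because \<open>\<phi>\<close> determines it only
  at points where the transform does not vanish.\<close>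

definition refinable :: "(real ^ 'n \<Rightarrow> complex) \<Rightarrow> (real ^ 'n \<Rightarrow> complex) \<Rightarrow> bool" where
  "refinable \<phi> a \<longleftrightarrow>
     (\<forall>\<xi>. \<forall>k\<in>integer_points. a (\<xi> + (2 * pi) *\<^sub>R k) = a \<xi>) \<and>
     (\<forall>\<xi>. fourier \<phi> (2 *\<^sub>R \<xi>) = a \<xi> * fourier \<phi> \<xi>) \<and>
     fourier \<phi> 0 = 1"

definition has_sum_rules :: "(real ^ 'n \<Rightarrow> complex) \<Rightarrow> nat \<Rightarrow> bool" where
  "has_sum_rules a m \<longleftrightarrow>
     (\<forall>\<gamma>. 2 *\<^sub>R \<gamma> \<in> integer_points \<and> \<gamma> \<notin> integer_points \<longrightarrow>
          (\<lambda>\<xi>. a (\<xi> + (2 * pi) *\<^sub>R \<gamma>)) \<in> O[at 0](\<lambda>\<xi>. complex_of_real (norm \<xi> ^ m)))"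

text \<open>Having \<open>\<kappa> + 1\<close> sum rules implies having fewer, so the order is the largest such number.\<close>

definition sum_rule_order :: "(real ^ 'n \<Rightarrow> complex) \<Rightarrow> ereal" where
  "sum_rule_order a = Sup {ereal (real (\<kappa> + 1)) | \<kappa>. has_sum_rules a (\<kappa> + 1)}"


subsection \<open>Index sets\<close>

text \<open>The box \<open>cbox (L_min \<Omega>) (L_max \<Omega>)\<close> is spanned by the integer points of \<open>\<Omega>\<close> and need not
  contain \<open>\<Omega>\<close>. Outside it the translates indexed by \<open>Lambda\<close> all vanish for large \<open>N\<close>, so
  approximation on \<open>\<Omega>\<close> requires the box to cover \<open>\<Omega>\<close> up to a null set.\<close>

definition L_min :: "(real ^ 'n) set \<Rightarrow> real ^ 'n" where
  "L_min \<Omega> = (\<chi> l. Min ((\<lambda>k. k $ l) ` (\<Omega> \<inter> integer_points)))"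

definition L_max :: "(real ^ 'n) set \<Rightarrow> real ^ 'n" where
  "L_max \<Omega> = (\<chi> l. Max ((\<lambda>k. k $ l) ` (\<Omega> \<inter> integer_points)))"

definition Lambda :: "(real ^ 'n) set \<Rightarrow> real ^ 'n \<Rightarrow> nat \<Rightarrow> (real ^ 'n) set" where
  "Lambda \<Omega> M N = {k \<in> integer_points.
     \<forall>l. 2 ^ N * L_min \<Omega> $ l - M $ l \<le> k $ l \<and> k $ l \<le> 2 ^ N * L_max \<Omega> $ l}"

type_synonym 'n triple = "(real ^ 'n) \<times> (real ^ 'n) \<times> (real ^ 'n)"

definition Xi_pl :: "(real ^ 'n) set \<Rightarrow> real ^ 'n \<Rightarrow> 'n \<Rightarrow> nat \<Rightarrow> 'n triple set" where
  "Xi_pl \<Omega> M j\<^sub>0 N = (\<lambda>k. (k, k + axis j\<^sub>0 1, k - axis j\<^sub>0 1)) ` Lambda \<Omega> M N"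

definition Xi_sph :: "(real ^ 'n) set \<Rightarrow> real ^ 'n \<Rightarrow> nat \<Rightarrow> 'n triple set" where
  "Xi_sph \<Omega> M N =
     (\<lambda>k. (k, (1 + 1 / 2 ^ N) *\<^sub>R k, (1 - 1 / 2 ^ N) *\<^sub>R k)) ` Lambda \<Omega> M N"

definition grid :: "nat \<Rightarrow> real ^ 'n \<Rightarrow> real ^ 'n" where
  "grid N k = (1 / 2 ^ N) *\<^sub>R k"


subsection \<open>Reference waves\<close>

definition plane_wave :: "(real ^ 'n \<Rightarrow> complex) \<Rightarrow> bool" where
  "plane_wave g \<longleftrightarrow>
     (\<exists>a K. a > 0 \<and> (\<forall>x. g x = complex_of_real a * exp (\<i> * complex_of_real (K \<bullet> x))))"

text \<open>The value at the origin is left unspecified.\<close>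

definition spherical_wave :: "(real ^ 'n \<Rightarrow> complex) \<Rightarrow> bool" where
  "spherical_wave g \<longleftrightarrow>
     (\<exists>b \<nu>. b > 0 \<and> \<nu> \<noteq> 0 \<and>
        (\<forall>x. x \<noteq> 0 \<longrightarrow>
           g x = complex_of_real (b / norm x) * exp (\<i> * complex_of_real (\<nu> * norm x))))"

definition admissibility_quotient ::
    "(real ^ 'n \<Rightarrow> complex) \<Rightarrow> real ^ 'n \<Rightarrow> real ^ 'n \<Rightarrow> real ^ 'n \<Rightarrow> ereal" where
  "admissibility_quotient g x x' x'' =
     (let num = max (cmod (g x - g x')) (cmod (cnj (g x) - cnj (g x'')));
          den = \<bar>Im ((g x - g x') * (cnj (g x) - cnj (g x'')))\<bar>
      in if den = 0 then \<infinity> else ereal (num / den))"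

definition admissible ::
    "real \<Rightarrow> ('n :: finite) triple set \<Rightarrow> nat \<Rightarrow> (real ^ 'n \<Rightarrow> complex) \<Rightarrow> bool" where
  "admissible \<gamma> \<Xi> N g \<longleftrightarrow>
     (\<forall>(k, k', k'')\<in>\<Xi>. g (grid N k) \<noteq> g (grid N k') \<and> g (grid N k) \<noteq> g (grid N k'')) \<and>
     (SUP (k, k', k'')\<in>\<Xi>. admissibility_quotient g (grid N k) (grid N k') (grid N k''))
       \<le> ereal \<gamma>"

definition uniformly_admissible ::
    "(nat \<Rightarrow> ('n :: finite) triple set) \<Rightarrow> (nat \<Rightarrow> real ^ 'n \<Rightarrow> complex) \<Rightarrow> bool" where
  "uniformly_admissible \<Xi> g \<longleftrightarrow>
     (\<exists>\<gamma>>0. \<forall>N\<ge>1. admissible \<gamma> (\<Xi> N) N (g N)) \<and>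
     (SUP N\<in>{1..}. SUP (k, k', k'')\<in>\<Xi> N.
        ereal (Max {cmod (g N (grid N k)), cmod (g N (grid N k')), cmod (g N (grid N k''))}))
       < \<infinity>"


subsection \<open>Reconstruction from intensities\<close>

definition intensity ::
    "(real ^ 'n \<Rightarrow> complex) \<Rightarrow> (real ^ 'n \<Rightarrow> complex) \<Rightarrow> real ^ 'n \<Rightarrow> real" where
  "intensity f g x = (cmod (f x + g x))\<^sup>2"

definition reconstructed_sample ::
    "(real ^ 'n \<Rightarrow> real) \<Rightarrow> (real ^ 'n \<Rightarrow> complex) \<Rightarrow>
     real ^ 'n \<Rightarrow> real ^ 'n \<Rightarrow> real ^ 'n \<Rightarrow> complex" where
  "reconstructed_sample I g x x' x'' =
     (let c = Re (g x - g x'); \<delta> = Im (g x - g x');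
          h = Re (g x - g x''); e = Im (g x - g x'');
          \<mu> = c * e - \<delta> * h;
          r\<^sub>1 = I x - I x' + (cmod (g x'))\<^sup>2 - (cmod (g x))\<^sup>2;
          r\<^sub>2 = I x - I x'' + (cmod (g x''))\<^sup>2 - (cmod (g x))\<^sup>2
      in Complex (1 / (2 * \<mu>) * (e * r\<^sub>1 - \<delta> * r\<^sub>2))
                 (1 / (2 * \<mu>) * (- h * r\<^sub>1 + c * r\<^sub>2)))"

text \<open>Both \<open>Xi_pl\<close> and \<open>Xi_sph\<close> contain exactly one triple for each \<open>k\<close> in \<open>Lambda\<close>, so summing over
  the triples is summing over \<open>Lambda\<close>.\<close>

definition approximant ::
    "('n :: finite) triple set \<Rightarrow> (real ^ 'n \<Rightarrow> complex) \<Rightarrow> nat \<Rightarrow>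
     (real ^ 'n \<Rightarrow> real) \<Rightarrow> (real ^ 'n \<Rightarrow> complex) \<Rightarrow> real ^ 'n \<Rightarrow> complex" where
  "approximant \<Xi> \<phi> N I g x =
     (\<Sum>(k, k', k'')\<in>\<Xi>.
        reconstructed_sample I g (grid N k) (grid N k') (grid N k'') * \<phi> (2 ^ N *\<^sub>R x - k))"

end

theory Submission
  imports Defs "HOL-Probability.Characteristic_Functions"
begin

text \<open>Write \<open>\<alpha> = min 1 (\<sigma> - s)\<close>. By Cauchy-Schwarz the weight \<open>norm \<xi> powr \<alpha>\<close> is integrable
  against the transform of \<open>f\<close>, so Fourier inversion makes \<open>f\<close> bounded and Hoelder continuous of
  order \<open>\<alpha>\<close>. The sum rules force the transform of \<open>\<phi>\<close> to vanish at all nonzero points of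
  \<open>2 \<pi> \<int>\<^sup>n\<close>, hence the integer translates of \<open>\<phi>\<close> sum to one. As \<open>\<phi>\<close> is nonnegative with small support,
  \<open>S\<^sub>N f\<close> at a point is a convex combination of reconstructed samples taken within distance
  \<open>O(2\<^sup>-\<^sup>N)\<close>. Admissibility bounds the error of each sample by the differences of \<open>f\<close> over
  the triple, so the approximation error is uniformly \<open>O(2 powr (- N * \<alpha>))\<close>, which is
  stronger than the claim.\<close>

subsection \<open>Integrals of product functions and Gaussians\<close>

text \<open>Elements of \<open>sobolev\<close> are functions, while their transforms are fixed only
  almost everywhere, so \<open>f\<close> has to be recovered pointwise. It is square integrable, but
  integrability and boundedness are not known beforehand. Inversion is therefore tested with
  Gaussians, whose transforms are explicit and can be paired with any square integrable function.
  The exponent enters through the factors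
  \<open>cmod (F \<xi>) * w \<xi> powr (\<sigma> / 2)\<close> and
  \<open>w \<xi> powr (- (\<sigma> - \<alpha>) / 2)\<close>, where
  \<open>w \<xi> = 1 + (norm \<xi>)\<^sup>2\<close>. The second is square integrable because
  \<sigma> - \<alpha> is at least \<open>s\<close>, hence above half the dimension. The cap at 1
  comes from \<open>cmod (iexp a - iexp b) \<le> 2 * \<bar>a - b\<bar> powr \<alpha>\<close>. The
  sum of the translates is identified without summing a Fourier series: it has the same coefficients
  as the constant one, and a continuous periodic function with zero coefficients vanishes by
  Stone-Weierstrass on the torus.\<close>

lemma lborel_integral_prod_Basis:
  fixes f :: "'a::euclidean_space \<Rightarrow> real \<Rightarrow> 'b::{real_normed_field,banach,second_countable_topology}"
  assumes int: "\<And>b. b \<in> Basis \<Longrightarrow> integrable lborel (f b)"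
  shows "integrable lborel (\<lambda>x. \<Prod>b\<in>Basis. f b (x \<bullet> b))" (is ?A)
    and "(LINT x|lborel. (\<Prod>b\<in>Basis. f b (x \<bullet> b))) = (\<Prod>b\<in>Basis. (LINT t|lborel. f b t))" (is ?B)
proof -
  interpret product_sigma_finite "\<lambda>_::'a. lborel :: real measure"
    by standard
  have [measurable]: "f b \<in> borel_measurable borel" if "b \<in> Basis" for b
    using borel_measurable_integrable[OF int[OF that]] by simp
  have meas: "(\<lambda>x. \<Prod>b\<in>Basis. f b (x \<bullet> b)) \<in> borel_measurable borel"
    by (intro borel_measurable_prod) measurable
  \<comment> \<open>\<open>lborel_eq\<close> writes Lebesgue measure as the image of the product
    measure under this map, so both claims pull back to the product.\<close>
  have T: "(\<lambda>x::'a \<Rightarrow> real. \<Sum>b\<in>Basis. x b *\<^sub>R b) \<in> (\<Pi>\<^sub>M b\<in>Basis. lborel) \<rightarrow>\<^sub>M borel"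
    by measurable
  have eq: "(\<Prod>b\<in>Basis. f b ((\<Sum>c\<in>Basis. x c *\<^sub>R c) \<bullet> b)) = (\<Prod>b\<in>Basis. f b (x b))" for x
    by (intro prod.cong refl arg_cong2[where f = f]) (simp add: inner_sum_left_Basis)
  have "integrable (\<Pi>\<^sub>M b\<in>Basis. lborel) (\<lambda>x. \<Prod>b\<in>Basis. f b (x b))"
    using int by (intro product_integrable_prod) auto
  then show ?A
    by (subst lborel_eq, subst integrable_distr_eq[OF T meas]) (simp add: eq)
  show ?B
    by (subst lborel_eq, subst integral_distr[OF T meas])
      (simp add: eq product_integral_prod int)
qed

section \<open>Affine changes of variable\<close>

lemma lborel_integrable_affine:
  fixes f :: "'a::euclidean_space \<Rightarrow> 'b::{banach,second_countable_topology}"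
  assumes "c \<noteq> 0" and int: "integrable lborel f"
  shows "integrable lborel (\<lambda>x. f (t + c *\<^sub>R x))"
proof -
  have [measurable]: "f \<in> borel_measurable borel"
    using borel_measurable_integrable[OF int] by simp
  have "integrable (density (distr lborel borel (\<lambda>x. t + c *\<^sub>R x)) (\<lambda>_. \<bar>c\<bar> ^ DIM('a))) f"
    using int lborel_affine[OF assms(1), of t] by simp
  then have "integrable lborel (\<lambda>x. (\<bar>c\<bar> ^ DIM('a)) *\<^sub>R f (t + c *\<^sub>R x))"
    by (simp add: integrable_density integrable_distr_eq)
  then have "integrable lborel (\<lambda>x. inverse (\<bar>c\<bar> ^ DIM('a)) *\<^sub>R ((\<bar>c\<bar> ^ DIM('a)) *\<^sub>R f (t + c *\<^sub>R x)))"
    by (rule integrable_scaleR_right)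
  then show ?thesis
    using assms(1) by simp
qed

text \<open>Holds for every \<open>f\<close>: by the inverse substitution, \<open>f\<close> and its
  rescaling are integrable together, and otherwise both integrals have the default value 0.\<close>

lemma lborel_integral_affine:
  fixes f :: "'a::euclidean_space \<Rightarrow> 'b::{banach,second_countable_topology}"
  assumes "c \<noteq> 0"
  shows "(LINT x|lborel. f x) = \<bar>c\<bar> ^ DIM('a) *\<^sub>R (LINT x|lborel. f (t + c *\<^sub>R x))"
proof (cases "integrable lborel f")
  case True
  then have [measurable]: "f \<in> borel_measurable borel"
    using borel_measurable_integrable by fastforce
  show ?thesis
    by (subst lborel_affine[OF assms, of t]) (simp add: integral_density integral_distr)
next
  case False
  have "\<not> integrable lborel (\<lambda>x. f (t + c *\<^sub>R x))"
  proof
    assume "integrable lborel (\<lambda>x. f (t + c *\<^sub>R x))"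
    then have "integrable lborel (\<lambda>x. f (t + c *\<^sub>R ((- t) /\<^sub>R c + (1 / c) *\<^sub>R x)))"
      using assms by (intro lborel_integrable_affine[where f = "\<lambda>x. f (t + c *\<^sub>R x)"]) auto
    then show False
      using assms False by (simp add: algebra_simps)
  qed
  with False show ?thesis
    by (simp add: not_integrable_integral_eq)
qed

text \<open>Scaled so that, in the convention of \<open>fourier\<close>, it is its own transform up
  to a factor \<open>sqrt (2 * pi)\<close> per dimension.\<close>

definition gaussian :: "'a::euclidean_space \<Rightarrow> real" where
  "gaussian x = exp (- (norm x)\<^sup>2 / 2)"

lemma gaussian_pos: "gaussian x > 0" and gaussian_le_1: "gaussian x \<le> 1"
  by (simp_all add: gaussian_def)

lemma continuous_gaussian: "continuous_on S gaussian"
  unfolding gaussian_def by (intro continuous_intros) auto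

lemma borel_measurable_gaussian [measurable]: "gaussian \<in> borel_measurable borel"
  using continuous_gaussian by (rule borel_measurable_continuous_onI)

lemma prod_gaussian: "gaussian x = (\<Prod>b\<in>Basis. exp (- (x \<bullet> b)\<^sup>2 / 2))"
proof -
  have "(norm x)\<^sup>2 = (\<Sum>b\<in>Basis. (x \<bullet> b)\<^sup>2)"
    unfolding power2_norm_eq_inner by (subst euclidean_inner) (simp add: power2_eq_square)
  then show ?thesis
    unfolding gaussian_def by (simp add: sum_negf flip: exp_sum sum_divide_distrib)
qed

lemma exp_inner_prod:
  "exp (- \<i> * complex_of_real (x \<bullet> y)) = (\<Prod>b\<in>Basis. exp (- \<i> * complex_of_real ((x \<bullet> b) * (y \<bullet> b))))"
  by (subst exp_sum[symmetric]) (simp_all add: euclidean_inner[of x y] sum_distrib_left sum_negf)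

text \<open>Up to the factor \<open>sqrt (2 * pi)\<close> this is the characteristic function of the
  standard normal distribution at \<open>- u\<close>.\<close>

lemma integral_gaussian_real:
  "integrable lborel (\<lambda>t. complex_of_real (exp (- t\<^sup>2 / 2)) * exp (- \<i> * complex_of_real (t * u)))"
      (is ?A)
  "(LINT t|lborel. complex_of_real (exp (- t\<^sup>2 / 2)) * exp (- \<i> * complex_of_real (t * u)))
     = complex_of_real (sqrt (2 * pi) * exp (- u\<^sup>2 / 2))" (is ?B)
proof -
  have eq: "complex_of_real (exp (- t\<^sup>2 / 2)) * exp (- \<i> * complex_of_real (t * u))
      = complex_of_real (sqrt (2 * pi)) * (std_normal_density t *\<^sub>R iexp (- u * t))" for t
    by (simp add: std_normal_density_def scaleR_conv_of_real mult_ac)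
  have i: "integrable lborel (\<lambda>t. std_normal_density t *\<^sub>R iexp (- u * t))"
    by (rule Bochner_Integration.integrable_bound[OF integrable_normal_density[of 1 0]])
      (auto simp: norm_mult)
  then show ?A
    unfolding eq by (rule integrable_mult_right)
  have "char std_normal_distribution (- u) = (LINT t|lborel. std_normal_density t *\<^sub>R iexp (- u * t))"
    unfolding char_def by (subst integral_density) auto
  then have "(LINT t|lborel. std_normal_density t *\<^sub>R iexp (- u * t))
      = complex_of_real (exp (- u\<^sup>2 / 2))"
    by (simp add: char_std_normal_distribution)
  then show ?B
    unfolding eq by (simp only: integral_mult_right_zero of_real_mult)
qed

lemma integral_gaussian:
  fixes y :: "'a::euclidean_space"
  shows "integrable lborel (\<lambda>x. complex_of_real (gaussian x) * exp (- \<i> * complex_of_real (x \<bullet> y)))"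
    and "(LINT x|lborel. complex_of_real (gaussian x) * exp (- \<i> * complex_of_real (x \<bullet> y)))
      = complex_of_real (sqrt (2 * pi) ^ DIM('a) * gaussian y)"
proof -
  let ?f = "\<lambda>b t. complex_of_real (exp (- t\<^sup>2 / 2)) * exp (- \<i> * complex_of_real (t * (y \<bullet> b)))"
  have eq: "complex_of_real (gaussian x) * exp (- \<i> * complex_of_real (x \<bullet> y))
      = (\<Prod>b\<in>Basis. ?f b (x \<bullet> b))" for x
    by (simp only: prod_gaussian exp_inner_prod prod.distrib of_real_prod)
  show "integrable lborel (\<lambda>x. complex_of_real (gaussian x) * exp (- \<i> * complex_of_real (x \<bullet> y)))"
    unfolding eq by (intro lborel_integral_prod_Basis integral_gaussian_real)
  show "(LINT x|lborel. complex_of_real (gaussian x) * exp (- \<i> * complex_of_real (x \<bullet> y)))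
      = complex_of_real (sqrt (2 * pi) ^ DIM('a) * gaussian y)"
    unfolding eq
    by (subst lborel_integral_prod_Basis(2)[OF integral_gaussian_real(1)],
        subst integral_gaussian_real(2)) (simp add: prod.distrib prod_gaussian)
qed

lemma integrable_gaussian: "integrable lborel (gaussian :: 'a::euclidean_space \<Rightarrow> real)"
proof -
  have "integrable lborel (\<lambda>x::'a. complex_of_real (gaussian x))"
    using integral_gaussian(1)[of "0::'a"] by simp
  then have "integrable lborel (\<lambda>x::'a. cmod (complex_of_real (gaussian x)))"
    by (rule integrable_norm)
  then show ?thesis
    by (simp add: abs_of_pos[OF gaussian_pos])
qed

lemma integral_gaussian_total:
  "(LINT x|lborel. gaussian (x::'a::euclidean_space)) = sqrt (2 * pi) ^ DIM('a)"
proof -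
  have "complex_of_real (LINT x|lborel. gaussian (x::'a)) = complex_of_real (sqrt (2 * pi) ^ DIM('a))"
    using integral_gaussian(2)[of "0::'a"] by (simp add: gaussian_def)
  then show ?thesis
    by (simp only: of_real_eq_iff)
qed

subsection \<open>The multiplication formula\<close>

lemma integrable_mult_bounded:
  fixes f g :: "'a \<Rightarrow> 'b::{real_normed_algebra,banach,second_countable_topology}"
  assumes f: "integrable M f" and [measurable]: "g \<in> borel_measurable M"
    and bd: "\<And>x. norm (g x) \<le> B"
  shows "integrable M (\<lambda>x. f x * g x)"
proof (rule Bochner_Integration.integrable_bound)
  show "integrable M (\<lambda>x. B * norm (f x))"
    using f by simp
  show "(\<lambda>x. f x * g x) \<in> borel_measurable M"
    using borel_measurable_integrable[OF f] by measurable
  have "norm (f x * g x) \<le> norm (B * norm (f x))" for x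
  proof -
    have "norm (f x * g x) \<le> norm (f x) * norm (g x)"
      by (rule norm_mult_ineq)
    also have "\<dots> \<le> norm (f x) * B"
      using bd by (simp add: mult_left_mono)
    also have "\<dots> \<le> norm (B * norm (f x))"
      by (simp add: mult.commute)
    finally show ?thesis .
  qed
  then show "AE x in M. norm (f x * g x) \<le> norm (B * norm (f x))"
    by simp
qed

lemma borel_measurable_cexp_inner [measurable]:
  "(\<lambda>x. exp (- \<i> * complex_of_real (x \<bullet> \<xi>))) \<in> borel_measurable borel"
  "(\<lambda>\<xi>. exp (- \<i> * complex_of_real (x \<bullet> \<xi>))) \<in> borel_measurable borel"
  "(\<lambda>\<xi>. exp (\<i> * complex_of_real (x \<bullet> \<xi>))) \<in> borel_measurable borel"
  by (intro borel_measurable_continuous_onI continuous_intros)+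

lemma integrable_fourier_kernel:
  fixes f :: "real ^ 'n \<Rightarrow> complex"
  assumes "integrable lborel f"
  shows "integrable lborel (\<lambda>x. f x * exp (- \<i> * complex_of_real (x \<bullet> \<xi>)))"
  using assms by (rule integrable_mult_bounded[where B = 1]) auto

lemma norm_fourier_le:
  fixes f :: "real ^ 'n \<Rightarrow> complex"
  shows "cmod (fourier f \<xi>) \<le> (LINT x|lborel. cmod (f x))"
  unfolding fourier_def
  by (rule order_trans[OF integral_norm_bound]) (simp add: norm_mult)

lemma borel_measurable_fourier [measurable]:
  fixes f :: "real ^ 'n \<Rightarrow> complex"
  assumes "integrable lborel f"
  shows "fourier f \<in> borel_measurable borel"
proof -
  have [measurable]: "f \<in> borel_measurable borel"
    using borel_measurable_integrable[OF assms] by simp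
  have [measurable]: "(\<lambda>z. exp (- \<i> * complex_of_real (snd z \<bullet> fst z))) \<in> borel_measurable (lborel
      \<Otimes>\<^sub>M (lborel :: (real^'n) measure))"
    unfolding lborel_prod by (simp, intro borel_measurable_continuous_onI continuous_intros)
  have "(\<lambda>\<xi>. LINT x|lborel. f x * exp (- \<i> * complex_of_real (x \<bullet> \<xi>))) \<in> borel_measurable lborel"
    by (rule lborel.borel_measurable_lebesgue_integral) (simp add: case_prod_unfold)
  then show ?thesis
    by (simp add: fourier_def[abs_def])
qed

lemma fourier_mult_swap:
  fixes f g :: "real ^ 'n \<Rightarrow> complex"
  assumes f: "integrable lborel f" and g: "integrable lborel g"
  shows "(LINT y|lborel. fourier f y * g y) = (LINT x|lborel. f x * fourier g x)"
proof -
  have [measurable]: "f \<in> borel_measurable borel" "g \<in> borel_measurable borel"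
    using borel_measurable_integrable[OF f] borel_measurable_integrable[OF g] by simp_all
  have [measurable]: "(\<lambda>z. exp (- \<i> * complex_of_real (fst z \<bullet> snd z))) \<in> borel_measurable (lborel
      \<Otimes>\<^sub>M (lborel :: (real^'n) measure))"
    unfolding lborel_prod by (simp, intro borel_measurable_continuous_onI continuous_intros)
  let ?K = "\<lambda>x y. f x * exp (- \<i> * complex_of_real (x \<bullet> y)) * g y"
  have "integrable (lborel \<Otimes>\<^sub>M lborel) (\<lambda>(x, y). ?K x y)"
  proof (rule lborel_pair.Fubini_integrable)
    show "(\<lambda>(x, y). ?K x y) \<in> borel_measurable (lborel \<Otimes>\<^sub>M lborel)"
      unfolding case_prod_unfold by measurable
    show "integrable lborel (\<lambda>x. LINT y|lborel. norm (case (x, y) of (x, y) \<Rightarrow> ?K x y))"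
      using f by (simp add: norm_mult)
    have "integrable lborel (?K x)" for x
      using integrable_mult_bounded[OF g, of "\<lambda>y. f x * exp (- \<i> * complex_of_real (x \<bullet> y))" "cmod
          (f x)"]
      by (simp add: norm_mult mult_ac)
    then show "AE x in lborel. integrable lborel (\<lambda>y. case (x, y) of (x, y) \<Rightarrow> ?K x y)"
      by simp
  qed
  from lborel_pair.Fubini_integral[OF this]
  have "(LINT y|lborel. LINT x|lborel. ?K x y) = (LINT x|lborel. LINT y|lborel. ?K x y)" .
  moreover have "(LINT x|lborel. ?K x y) = fourier f y * g y" for y
    using integrable_fourier_kernel[OF f] by (simp add: fourier_def)
  moreover have "(LINT y|lborel. ?K x y) = f x * fourier g x" for x
  proof -
    have "?K x y = f x * (g y * exp (- \<i> * complex_of_real (y \<bullet> x)))" for y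
      by (simp add: inner_commute mult_ac)
    then show ?thesis
      by (simp only: fourier_def integral_mult_right_zero)
  qed
  ultimately show ?thesis
    by (simp only:)
qed

text \<open>Cauchy-Schwarz bounds the squared difference of the integrals by the squared L2 distance
  times the squared norm of \<psi>. The estimate is made in \<open>ennreal\<close>, where
  \<open>L2_converges\<close> lives and where a distance may be infinite for some
  \<open>n\<close>.\<close>

lemma L2_converges_integral:
  fixes f \<psi> :: "real ^ 'n \<Rightarrow> complex"
  assumes conv: "L2_converges h f"
    and [measurable]: "\<And>n. h n \<in> borel_measurable lborel" "f \<in> borel_measurable lborel"
    and \<psi>: "square_integrable \<psi>"
    and int: "\<And>n. integrable lborel (\<lambda>x. h n x * \<psi> x)" "integrable lborel (\<lambda>x. f x * \<psi> x)"
  shows "(\<lambda>n. LINT x|lborel. h n x * \<psi> x) \<longlonglongrightarrow> (LINT x|lborel. f x * \<psi> x)"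
proof -
  define D where "D n = cmod ((LINT x|lborel. h n x * \<psi> x) - (LINT x|lborel. f x * \<psi> x))" for n
  define B where "B = (\<integral>\<^sup>+ x. ennreal ((cmod (\<psi> x))\<^sup>2) \<partial>lborel)"
  have [measurable]: "\<psi> \<in> borel_measurable lborel" and B: "B < \<infinity>"
    using \<psi> by (auto simp: square_integrable_def B_def integrable_iff_bounded)
  have le: "ennreal ((D n)\<^sup>2) \<le> (\<integral>\<^sup>+ x. ennreal ((cmod (h n x - f x))\<^sup>2) \<partial>lborel) * B" for n
  proof -
    have "(LINT x|lborel. h n x * \<psi> x) - (LINT x|lborel. f x * \<psi> x) = (LINT x|lborel. (h n x
        - f x) * \<psi> x)"
      using int by (simp add: left_diff_distrib)
    then have "ennreal (D n) \<le> (\<integral>\<^sup>+ x. ennreal (cmod ((h n x - f x) * \<psi> x)) \<partial>lborel)"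
      unfolding D_def using int
      by (simp only:) (rule integral_norm_bound_ennreal, simp add: left_diff_distrib)
    then have "ennreal ((D n)\<^sup>2) \<le> (\<integral>\<^sup>+ x. ennreal (cmod (h n x
        - f x)) * ennreal (cmod (\<psi> x)) \<partial>lborel)\<^sup>2"
      by (simp add: norm_mult ennreal_mult power_mono D_def flip: ennreal_power)
    also have "\<dots> \<le> (\<integral>\<^sup>+ x. (ennreal (cmod (h n x - f x)))\<^sup>2 \<partial>lborel) * (\<integral>\<^sup>+ x. (ennreal (cmod (\<psi>
        x)))\<^sup>2 \<partial>lborel)"
      by (rule Cauchy_Schwarz_nn_integral) measurable
    finally show ?thesis
      by (simp add: B_def ennreal_power)
  qed
  \<comment> \<open>Finiteness of \<open>B\<close> rules out the indeterminate product of 0 and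
    \<infinity>.\<close>
  have "(\<lambda>n. (\<integral>\<^sup>+ x. ennreal ((cmod (h n x - f x))\<^sup>2) \<partial>lborel) * B) \<longlonglongrightarrow> 0 * B"
    using conv B unfolding L2_converges_def by (intro tendsto_mult_ennreal) auto
  then have lim: "(\<lambda>n. (\<integral>\<^sup>+ x. ennreal ((cmod (h n x - f x))\<^sup>2) \<partial>lborel) * B) \<longlonglongrightarrow> 0"
    by (simp only: mult_zero_left)
  have "(\<lambda>n. ennreal ((D n)\<^sup>2)) \<longlonglongrightarrow> 0"
    by (rule tendsto_sandwich[OF _ _ tendsto_const lim]; intro always_eventually allI le zero_le)
  then have "(\<lambda>n. (D n)\<^sup>2) \<longlonglongrightarrow> 0"
    using tendsto_ennrealD[where x = 0 and f = "\<lambda>n. (D n)\<^sup>2"] by simp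
  then have "(\<lambda>n. sqrt ((D n)\<^sup>2)) \<longlonglongrightarrow> sqrt 0"
    by (rule tendsto_real_sqrt)
  then have "D \<longlonglongrightarrow> 0"
    by (simp add: D_def[abs_def])
  then show ?thesis
    unfolding D_def[abs_def] by (rule LIM_zero_cancel[OF tendsto_norm_zero_cancel])
qed

lemma integrable_mult_square_integrable:
  fixes f \<psi> :: "real ^ 'n \<Rightarrow> complex"
  assumes "square_integrable f" "square_integrable \<psi>"
  shows "integrable lborel (\<lambda>x. f x * \<psi> x)"
proof (rule Bochner_Integration.integrable_bound)
  show "integrable lborel (\<lambda>x. (cmod (f x))\<^sup>2 + (cmod (\<psi> x))\<^sup>2)"
    using assms by (simp add: square_integrable_def)
  show "(\<lambda>x. f x * \<psi> x) \<in> borel_measurable lborel"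
    using assms unfolding square_integrable_def by (intro borel_measurable_times) auto
  have "cmod (f x * \<psi> x) \<le> norm ((cmod (f x))\<^sup>2 + (cmod (\<psi> x))\<^sup>2)" for x
  proof -
    have "cmod (f x) * cmod (\<psi> x) \<ge> 0"
      by simp
    then show ?thesis
      using sum_squares_bound[of "cmod (f x)" "cmod (\<psi> x)"]
      unfolding norm_mult real_norm_def by linarith
  qed
  then show "AE x in lborel. cmod (f x * \<psi> x) \<le> norm ((cmod (f x))\<^sup>2 + (cmod (\<psi> x))\<^sup>2)"
    by simp
qed

text \<open>The formula holds along the approximating sequence by \<open>fourier_mult_swap\<close>.
  The left side passes to the limit because \<psi> is square integrable, the right side because
  \<open>fourier \<psi>\<close> is. This is the form in which the relation
  \<open>has_fourier_L2\<close> is put to use.\<close>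

lemma has_fourier_L2_mult_swap:
  fixes f F \<psi> :: "real ^ 'n \<Rightarrow> complex"
  assumes fF: "has_fourier_L2 f F"
    and \<psi>: "integrable lborel \<psi>" "square_integrable \<psi>" "square_integrable (fourier \<psi>)"
  shows "(LINT y|lborel. F y * \<psi> y) = (LINT x|lborel. f x * fourier \<psi> x)"
proof -
  obtain h where h: "\<And>n. integrable lborel (h n)" "\<And>n. square_integrable (h n)"
    and conv: "L2_converges h f" "L2_converges (\<lambda>n. fourier (h n)) F"
    and f: "square_integrable f" and F: "square_integrable F"
    using fF unfolding has_fourier_L2_def by blast
  have [measurable]: "f \<in> borel_measurable lborel" "F \<in> borel_measurable lborel"
     "h n \<in> borel_measurable lborel" "fourier (h n) \<in> borel_measurable lborel" for n
    using f F h borel_measurable_fourier by (auto simp: square_integrable_def)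
  have "(\<lambda>n. LINT x|lborel. h n x * fourier \<psi> x) \<longlonglongrightarrow> (LINT x|lborel. f x * fourier \<psi> x)"
    using conv f h \<psi> by (intro L2_converges_integral integrable_mult_square_integrable) auto
  moreover have "(\<lambda>n. LINT x|lborel. fourier (h n) x * \<psi> x) \<longlonglongrightarrow> (LINT x|lborel. F x * \<psi> x)"
  proof (rule L2_converges_integral[OF conv(2)])
    show "integrable lborel (\<lambda>x. fourier (h n) x * \<psi> x)" for n
      using integrable_mult_bounded[OF \<psi>(1), of "fourier (h n)", OF _ norm_fourier_le]
      by (auto simp: mult.commute)
  qed (auto intro: \<psi> integrable_mult_square_integrable F)
  ultimately show ?thesis
    unfolding fourier_mult_swap[OF h(1) \<psi>(1)] by (rule LIMSEQ_unique[rotated])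
qed

subsection \<open>Fourier inversion\<close>

text \<open>The test functions for inversion: paired with \<open>F\<close> they give a regularized
  inversion integral at \<open>x\<close>, and their transform is a bump of width \<open>e\<close>
  around \<open>x\<close>.\<close>

lemma fourier_modulated_gaussian:
  fixes x :: "real ^ 'n"
  assumes "e > 0"
  defines "\<psi> \<equiv> \<lambda>\<xi>. exp (\<i> * complex_of_real (x \<bullet> \<xi>)) * complex_of_real (gaussian (e *\<^sub>R \<xi>))"
  shows "integrable lborel \<psi>"
    and "fourier \<psi> y = complex_of_real ((sqrt (2 * pi) / e) ^ CARD('n) * gaussian ((1 / e) *\<^sub>R (y - x)))"
proof -
  let ?h = "\<lambda>y \<eta>. complex_of_real (gaussian \<eta>) * exp (- \<i> * complex_of_real (\<eta> \<bullet> ((1 / e) *\<^sub>R (y - x))))"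
  have eq: "\<psi> \<xi> * exp (- \<i> * complex_of_real (\<xi> \<bullet> y)) = ?h y (0 + e *\<^sub>R \<xi>)" for \<xi> y
    using assms by (simp add: mult_ac inner_diff_right inner_commute algebra_simps flip: exp_add)
  show "integrable lborel \<psi>"
  proof -
    have "integrable lborel (\<lambda>\<xi>. ?h 0 (0 + e *\<^sub>R \<xi>))"
      using assms(1) by (intro lborel_integrable_affine integral_gaussian(1)) auto
    then show ?thesis
      unfolding eq[symmetric] by simp
  qed
  have "complex_of_real (sqrt (2 * pi) ^ CARD('n) * gaussian ((1 / e) *\<^sub>R (y - x)))
      = (LINT \<eta>|lborel. ?h y \<eta>)"
    by (subst integral_gaussian(2)) simp
  also have "\<dots> = e ^ CARD('n) *\<^sub>R fourier \<psi> y"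
    unfolding fourier_def eq using assms(1) by (subst lborel_integral_affine[of e _ 0]) auto
  finally show "fourier \<psi> y = complex_of_real ((sqrt (2 * pi) / e) ^ CARD('n) * gaussian ((1 / e)
      *\<^sub>R (y - x)))"
    using assms(1) by (simp add: scaleR_conv_of_real field_simps power_divide)
qed

lemma square_gaussian: "(gaussian x)\<^sup>2 = gaussian (sqrt 2 *\<^sub>R x)"
  by (simp add: gaussian_def power_mult_distrib flip: exp_double)

lemma integrable_gaussian_affine:
  "c \<noteq> 0 \<Longrightarrow> integrable lborel (\<lambda>x. gaussian (t + c *\<^sub>R (x :: 'a::euclidean_space)))"
  by (rule lborel_integrable_affine[OF _ integrable_gaussian])

text \<open>Since \<open>f\<close> is only square integrable, dominated convergence works only near
  \<open>x\<close>, where continuity bounds \<open>f\<close>. The rest of \<open>f\<close> is seen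
  by the Gaussian only where \<open>norm z\<close> is at least \<open>\<delta> / r n\<close>, and
  the decay there beats the growth of the L2 norm under rescaling.\<close>

lemma gaussian_convolution_tendsto:
  fixes f :: "real ^ 'n \<Rightarrow> complex"
  assumes f: "square_integrable f" and cont: "continuous (at x) f"
  shows "(\<lambda>n. LINT z|lborel. f (x + (1 / real (Suc n)) *\<^sub>R z) * complex_of_real (gaussian z))
    \<longlonglongrightarrow> f x * complex_of_real (sqrt (2 * pi) ^ CARD('n))"
proof -
  have [measurable]: "f \<in> borel_measurable borel"
    using f by (simp add: square_integrable_def)
  obtain \<delta> where \<delta>: "\<delta> > 0" "\<And>y. dist y x < \<delta> \<Longrightarrow> dist (f y) (f x) < 1"
    using cont unfolding continuous_at_eps_delta by (metis zero_less_one)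
  define f1 where "f1 y = indicator (ball x \<delta>) y * f y" for y
  define f2 where "f2 y = indicator (- ball x \<delta>) y * f y" for y
  have f12: "f y = f1 y + f2 y" for y
    by (auto simp: f1_def f2_def indicator_def)
  have [measurable]: "f1 \<in> borel_measurable borel" "f2 \<in> borel_measurable borel"
    unfolding f1_def[abs_def] f2_def[abs_def]
    by (auto intro!: borel_measurable_times borel_measurable_indicator)
  have bd: "cmod (f1 y) \<le> cmod (f x) + 1" for y
  proof (cases "y \<in> ball x \<delta>")
    case True
    then have "cmod (f y - f x) < 1"
      using \<delta>(2)[of y] by (simp add: dist_norm norm_minus_commute)
    then show ?thesis
      using True norm_triangle_sub[of "f y" "f x"] by (simp add: f1_def)
  qed (simp add: f1_def)
  define r where "r n = 1 / real (Suc n)" for n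
  have r: "r n > 0" for n
    by (simp add: r_def)
  have r0: "r \<longlonglongrightarrow> 0"
    unfolding r_def using LIMSEQ_inverse_real_of_nat by (simp add: inverse_eq_divide)
  have int1: "integrable lborel (\<lambda>z. f1 (x + r n *\<^sub>R z) * complex_of_real (gaussian z))" for n
    by (rule Bochner_Integration.integrable_bound[of _ "\<lambda>z. (cmod (f x) + 1) * gaussian z"])
      (auto simp: norm_mult integrable_gaussian gaussian_pos less_imp_le bd abs_of_pos intro!:
          mult_right_mono bd order_trans[OF bd])
  have lim1: "(\<lambda>n. LINT z|lborel. f1 (x + r n *\<^sub>R z) * complex_of_real (gaussian z))
    \<longlonglongrightarrow> (LINT z|lborel. f x * complex_of_real (gaussian (z :: real ^ 'n)))"
  proof (rule integral_dominated_convergence[where w = "\<lambda>z. (cmod (f x) + 1) * gaussian z"])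
    have "(\<lambda>n. f1 (x + r n *\<^sub>R z) * complex_of_real (gaussian z))
        \<longlonglongrightarrow> f x * complex_of_real (gaussian z)" for z
    proof (intro tendsto_mult tendsto_const)
      have xr: "(\<lambda>n. x + r n *\<^sub>R z) \<longlonglongrightarrow> x"
        using tendsto_add[OF tendsto_const tendsto_scaleR[OF r0 tendsto_const]] by fastforce
      then have "(\<lambda>n. f (x + r n *\<^sub>R z)) \<longlonglongrightarrow> f x"
        using cont isCont_tendsto_compose by blast
      moreover have "\<forall>\<^sub>F n in sequentially. f (x + r n *\<^sub>R z) = f1 (x + r n *\<^sub>R z)"
        using topological_tendstoD[OF xr open_ball, of x \<delta>] \<delta>(1)
        by (auto simp: f1_def elim: eventually_mono)
      ultimately show "(\<lambda>n. f1 (x + r n *\<^sub>R z)) \<longlonglongrightarrow> f x"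
        by (rule Lim_transform_eventually)
    qed
    then show "AE z in lborel. (\<lambda>n. f1 (x + r n *\<^sub>R z) * complex_of_real (gaussian z))
        \<longlonglongrightarrow> f x * complex_of_real (gaussian z)"
      by simp
    show "AE z in lborel. norm (f1 (x + r n *\<^sub>R z) * complex_of_real (gaussian z)) \<le> (cmod (f x)
        + 1) * gaussian z" for n
      by (simp add: norm_mult gaussian_pos less_imp_le abs_of_pos mult_right_mono bd)
    show "integrable lborel (\<lambda>z::real^'n. (cmod (f x) + 1) * gaussian z)"
      by (simp add: integrable_gaussian)
  qed measurable
  define A where "A = (LINT y|lborel. (cmod (f y))\<^sup>2)"
  define B where "B = (LINT z|lborel. gaussian (z :: real ^ 'n))"
  have fsq: "integrable lborel (\<lambda>y. (cmod (f y))\<^sup>2)"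
    using f by (simp add: square_integrable_def)
  have fr: "integrable lborel (\<lambda>z. (cmod (f (x + r n *\<^sub>R z)))\<^sup>2)" for n
    using lborel_integrable_affine[OF _ fsq, of "r n" x] r[of n] by simp
  \<comment> \<open>AM-GM against one square root of the Gaussian; the other one is small where \<open>f2\<close> lives.\<close>
  have tail: "cmod (f2 (x + r n *\<^sub>R z) * complex_of_real (gaussian z))
      \<le> exp (- (\<delta> / r n)\<^sup>2 / 4) * ((cmod (f (x + r n *\<^sub>R z)))\<^sup>2 + gaussian z)" for n z
  proof (cases "x + r n *\<^sub>R z \<in> ball x \<delta>")
    case True
    then show ?thesis
      by (simp add: f2_def gaussian_pos add_nonneg_nonneg less_imp_le)
  next
    case False
    then have "\<delta> / r n \<le> norm z"
      using r[of n] by (simp add: dist_norm field_simps)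
    then have "(\<delta> / r n)\<^sup>2 \<le> (norm z)\<^sup>2"
      using \<delta>(1) r[of n] by (intro power_mono) (auto simp: less_imp_le)
    define q where "q = exp (- (norm z)\<^sup>2 / 4)"
    have q: "q \<ge> 0" "q \<le> exp (- (\<delta> / r n)\<^sup>2 / 4)" "gaussian z = q * q"
      using \<open>(\<delta> / r n)\<^sup>2 \<le> (norm z)\<^sup>2\<close> by (simp_all add: q_def gaussian_def flip: exp_add)
    let ?c = "cmod (f (x + r n *\<^sub>R z))"
    have "?c * q \<le> ?c\<^sup>2 + q * q"
    proof -
      have "?c * q \<ge> 0" using q by simp
      then show ?thesis
        using sum_squares_bound[of ?c q] by (simp add: power2_eq_square)
    qed
    have "cmod (f2 (x + r n *\<^sub>R z) * complex_of_real (gaussian z)) = q * (?c * q)"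
      using False q by (simp add: f2_def norm_mult)
    also have "\<dots> \<le> exp (- (\<delta> / r n)\<^sup>2 / 4) * (?c\<^sup>2 + q * q)"
      using q \<open>?c * q \<le> ?c\<^sup>2 + q * q\<close> by (intro mult_mono) auto
    finally show ?thesis
      using q by simp
  qed
  have int2: "integrable lborel (\<lambda>z. f2 (x + r n *\<^sub>R z) * complex_of_real (gaussian z))" for n
  proof (rule Bochner_Integration.integrable_bound)
    show "integrable lborel (\<lambda>z. exp (- (\<delta> / r n)\<^sup>2 / 4) * ((cmod (f (x + r n *\<^sub>R z)))\<^sup>2 + gaussian z))"
      using fr[of n] integrable_gaussian by (intro integrable_mult_right
          Bochner_Integration.integrable_add)
    show "AE z in lborel. norm (f2 (x + r n *\<^sub>R z) * complex_of_real (gaussian z))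
      \<le> norm (exp (- (\<delta> / r n)\<^sup>2 / 4) * ((cmod (f (x + r n *\<^sub>R z)))\<^sup>2 + gaussian z))"
      using order_trans[OF tail abs_ge_self] by (intro AE_I2) (simp only: real_norm_def)
  qed measurable
  \<comment> \<open>Undoing the substitution costs one factor \<open>Suc n\<close> per dimension, a
    polynomial against the exponential.\<close>
  have bd2: "cmod (LINT z|lborel. f2 (x + r n *\<^sub>R z) * complex_of_real (gaussian z))
      \<le> exp (- (\<delta> / r n)\<^sup>2 / 4) * (real (Suc n) ^ CARD('n) * A + B)" for n
  proof -
    have "A = r n ^ CARD('n) * (LINT z|lborel. (cmod (f (x + r n *\<^sub>R z)))\<^sup>2)"
      unfolding A_def using r[of n] by (subst lborel_integral_affine[of "r n" _ x]) auto
    then have "(LINT z|lborel. (cmod (f (x + r n *\<^sub>R z)))\<^sup>2) = real (Suc n) ^ CARD('n) * A"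
      by (simp add: r_def power_divide)
    moreover have "(LINT z|lborel. exp (- (\<delta> / r n)\<^sup>2 / 4) * ((cmod (f (x + r n *\<^sub>R z)))\<^sup>2 + gaussian z))
       = exp (- (\<delta> / r n)\<^sup>2 / 4) * ((LINT z|lborel. (cmod (f (x + r n *\<^sub>R z)))\<^sup>2) + B)"
      unfolding B_def integral_mult_right_zero
      by (subst Bochner_Integration.integral_add[OF fr integrable_gaussian]) simp
    moreover have "cmod (LINT z|lborel. f2 (x + r n *\<^sub>R z) * complex_of_real (gaussian z))
      \<le> (LINT z|lborel. exp (- (\<delta> / r n)\<^sup>2 / 4) * ((cmod (f (x + r n *\<^sub>R z)))\<^sup>2 + gaussian z))"
      using fr[of n] integrable_gaussian int2[of n] tail
      by (intro order_trans[OF integral_norm_bound] integral_mono integrable_mult_right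
            Bochner_Integration.integrable_add integrable_norm)
    ultimately show ?thesis
      by simp
  qed
  have lim2: "(\<lambda>n. LINT z|lborel. f2 (x + r n *\<^sub>R z) * complex_of_real (gaussian z)) \<longlonglongrightarrow> 0"
  proof (rule Lim_null_comparison)
    show "\<forall>\<^sub>F n in sequentially. cmod (LINT z|lborel. f2 (x + r n *\<^sub>R z) * complex_of_real (gaussian z))
      \<le> exp (- (\<delta> / r n)\<^sup>2 / 4) * (real (Suc n) ^ CARD('n) * A + B)"
      using bd2 by simp
    \<comment> \<open>The exponent \<open>(\<delta> / r n)\<^sup>2 / 4\<close> equals
      \<open>c * (Suc n)\<^sup>2\<close>. It is weakened to \<open>c * Suc n\<close>, so that the
      limit of a power over an exponential applies.\<close>
    define c where "c = \<delta>\<^sup>2 / 4"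
    have c: "c > 0"
      using \<delta>(1) by (simp add: c_def)
    have "filterlim (\<lambda>n. c * real (Suc n)) at_top sequentially"
      by (rule filterlim_tendsto_pos_mult_at_top[OF tendsto_const c
            filterlim_compose[OF filterlim_real_sequentially filterlim_Suc]])
    then have lim: "(\<lambda>n. (c * real (Suc n)) ^ k / exp (c * real (Suc n))) \<longlonglongrightarrow> 0" for k
      by (rule filterlim_compose[OF tendsto_power_div_exp_0])
    have "(\<lambda>n. A / c ^ CARD('n) * ((c * real (Suc n)) ^ CARD('n) / exp (c * real (Suc n)))
        + B * ((c * real (Suc n)) ^ 0 / exp (c * real (Suc n)))) \<longlonglongrightarrow> A / c ^ CARD('n) * 0 + B * 0"
      by (intro tendsto_add tendsto_mult tendsto_const lim)
    moreover have "A / c ^ CARD('n) * ((c * m) ^ CARD('n) / exp (c * m))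
        + B * ((c * m) ^ 0 / exp (c * m))
        = exp (- (c * m)) * (m ^ CARD('n) * A + B)" for m
      using c by (simp add: power_mult_distrib exp_minus field_simps)
    ultimately have lim': "(\<lambda>n. exp (- (c * real (Suc n))) * (real (Suc n) ^ CARD('n) * A + B)) \<longlonglongrightarrow> 0"
      by (simp only: mult_zero_right add_0_right)
    have AB: "A \<ge> 0" "B \<ge> 0"
      by (simp_all add: A_def B_def gaussian_pos less_imp_le)
    have "exp (- (\<delta> / r n)\<^sup>2 / 4) \<le> exp (- (c * real (Suc n)))" for n
    proof -
      have "(\<delta> / r n)\<^sup>2 / 4 = c * real (Suc n) * real (Suc n)"
        by (simp add: r_def c_def power2_eq_square)
      also have "\<dots> \<ge> c * real (Suc n) * 1"
        using c by (intro mult_left_mono) auto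
      finally show ?thesis
        by simp
    qed
    then show "(\<lambda>n. exp (- (\<delta> / r n)\<^sup>2 / 4) * (real (Suc n) ^ CARD('n) * A + B)) \<longlonglongrightarrow> 0"
      using AB by (intro tendsto_sandwich[OF _ _ tendsto_const lim'])
        (auto intro!: always_eventually mult_right_mono)
  qed
  have "(\<lambda>n. (LINT z|lborel. f1 (x + r n *\<^sub>R z) * complex_of_real (gaussian z))
      + (LINT z|lborel. f2 (x + r n *\<^sub>R z) * complex_of_real (gaussian z)))
    \<longlonglongrightarrow> (LINT z|lborel. f x * complex_of_real (gaussian (z :: real ^ 'n))) + 0"
    by (rule tendsto_add[OF lim1 lim2])
  moreover have "(LINT z|lborel. f1 (x + r n *\<^sub>R z) * complex_of_real (gaussian z))
      + (LINT z|lborel. f2 (x + r n *\<^sub>R z) * complex_of_real (gaussian z))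
    = (LINT z|lborel. f (x + r n *\<^sub>R z) * complex_of_real (gaussian z))" for n
    using int1[of n] int2[of n] by (simp add: f12 distrib_right)
  moreover have "(LINT z|lborel. f x * complex_of_real (gaussian (z :: real ^ 'n)))
      = f x * complex_of_real (sqrt (2 * pi) ^ CARD('n))"
    by (simp add: integral_gaussian_total)
  ultimately show ?thesis
    unfolding r_def by (simp only: add_0_right)
qed

text \<open>Both sides of the multiplication formula are tested with modulated Gaussians of growing width.\<close>

theorem fourier_L2_inversion:
  fixes f F :: "real ^ 'n \<Rightarrow> complex"
  assumes fF: "has_fourier_L2 f F" and F: "integrable lborel F" and cont: "continuous (at x) f"
  shows "(LINT \<xi>|lborel. F \<xi> * exp (\<i> * complex_of_real (x \<bullet> \<xi>)))
      = complex_of_real ((2 * pi) ^ CARD('n)) * f x"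
proof -
  define r where "r n = 1 / real (Suc n)" for n
  have r: "r n > 0" for n
    by (simp add: r_def)
  have r0: "r \<longlonglongrightarrow> 0"
    unfolding r_def using LIMSEQ_inverse_real_of_nat by (simp add: inverse_eq_divide)
  have f: "square_integrable f"
    using fF by (simp add: has_fourier_L2_def)
  define \<psi> where "\<psi> n \<xi> = exp (\<i> * complex_of_real (x \<bullet> \<xi>)) * complex_of_real (gaussian (r n *\<^sub>R
      \<xi>))" for n \<xi>
  have [measurable]: "\<psi> n \<in> borel_measurable borel" "F \<in> borel_measurable borel" for n
    unfolding \<psi>_def[abs_def] using borel_measurable_integrable[OF F] by simp_all
  note \<psi> = fourier_modulated_gaussian[OF r, where x = x, folded \<psi>_def]
  have \<psi>_le: "cmod (\<psi> n \<xi>) \<le> 1" for n \<xi>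
    by (simp add: \<psi>_def norm_mult gaussian_pos less_imp_le abs_of_pos gaussian_le_1)
  have lhs: "(\<lambda>n. LINT \<xi>|lborel. F \<xi> * \<psi> n \<xi>) \<longlonglongrightarrow> (LINT \<xi>|lborel. F \<xi> * exp (\<i> * complex_of_real (x \<bullet> \<xi>)))"
  proof (rule integral_dominated_convergence[where w = "\<lambda>\<xi>. cmod (F \<xi>)"])
    have "(\<lambda>n. F \<xi> * \<psi> n \<xi>) \<longlonglongrightarrow> F \<xi> * (exp (\<i> * complex_of_real (x \<bullet> \<xi>)) * complex_of_real (gaussian
        (0 *\<^sub>R \<xi>)))" for \<xi>
      unfolding \<psi>_def
      by (intro tendsto_mult tendsto_const tendsto_of_real
          continuous_on_tendsto_compose[OF continuous_gaussian[of UNIV]] tendsto_scaleR r0) auto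
    then show "AE \<xi> in lborel. (\<lambda>n. F \<xi> * \<psi> n \<xi>) \<longlonglongrightarrow> F \<xi> * exp (\<i> * complex_of_real (x \<bullet> \<xi>))"
      by (simp add: gaussian_def)
    show "AE \<xi> in lborel. norm (F \<xi> * \<psi> n \<xi>) \<le> cmod (F \<xi>)" for n
      using \<psi>_le by (simp add: norm_mult mult_left_le)
  qed (use F in auto)
  have "(LINT \<xi>|lborel. F \<xi> * \<psi> n \<xi>)
      = complex_of_real (sqrt (2 * pi) ^ CARD('n)) * (LINT z|lborel. f (x
          + r n *\<^sub>R z) * complex_of_real (gaussian z))" for n
  proof -
    have sq\<psi>: "square_integrable (\<psi> n)"
      unfolding square_integrable_def
    proof
      have "(cmod (\<psi> n \<xi>))\<^sup>2 \<le> cmod (\<psi> n \<xi>)" for \<xi>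
        using \<psi>_le[of n \<xi>] by (simp add: power2_eq_square mult_left_le norm_mult)
      then show "integrable lborel (\<lambda>\<xi>. (cmod (\<psi> n \<xi>))\<^sup>2)"
        by (intro Bochner_Integration.integrable_bound[OF \<psi>(1)[of n]]) auto
    qed simp
    have sqf: "square_integrable (fourier (\<psi> n))"
      unfolding square_integrable_def
    proof
      have "(cmod (fourier (\<psi> n) y))\<^sup>2 = ((sqrt (2 * pi) / r n) ^ CARD('n))\<^sup>2 * gaussian (- (sqrt 2
          / r n) *\<^sub>R x + (sqrt 2 / r n) *\<^sub>R y)" for y
      proof -
        have "sqrt 2 *\<^sub>R (1 / r n) *\<^sub>R (y - x) = - (sqrt 2 / r n) *\<^sub>R x + (sqrt 2 / r n) *\<^sub>R y"
          by (simp add: algebra_simps)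
        then show ?thesis
          unfolding \<psi>(2) norm_of_real power2_abs power_mult_distrib square_gaussian by simp
      qed
      then show "integrable lborel (\<lambda>y. (cmod (fourier (\<psi> n) y))\<^sup>2)"
        using r[of n] by (simp only:) (intro integrable_mult_right integrable_gaussian_affine, auto)
    qed (use \<psi>(1) in simp)
    have "(LINT \<xi>|lborel. F \<xi> * \<psi> n \<xi>) = (LINT y|lborel. f y * fourier (\<psi> n) y)"
      by (rule has_fourier_L2_mult_swap[OF fF \<psi>(1) sq\<psi> sqf])
    \<comment> \<open>The Jacobian of \<open>y = x + r n *\<^sub>R z\<close> cancels the powers of
      \<open>r n\<close> in \<open>fourier (\<psi> n)\<close>; what remains is the Gaussian average
      of \<open>f\<close> around \<open>x\<close>.\<close>
    also have "\<dots> = r n ^ CARD('n) *\<^sub>R (LINT z|lborel. f (x + r n *\<^sub>R z) * fourier (\<psi> n) (x + r n *\<^sub>R z))"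
      using r[of n] by (subst lborel_integral_affine[of "r n" _ x]) auto
    also have "\<dots> = (LINT z|lborel. r n ^ CARD('n) *\<^sub>R (f (x + r n *\<^sub>R z) * fourier (\<psi> n) (x
        + r n *\<^sub>R z)))"
      by simp
    also have "\<dots> = (LINT z|lborel. complex_of_real (sqrt (2 * pi) ^ CARD('n)) * (f (x
        + r n *\<^sub>R z) * complex_of_real (gaussian z)))"
    proof (intro Bochner_Integration.integral_cong refl)
      fix z
      have "(1 / r n) *\<^sub>R (x + r n *\<^sub>R z - x) = z"
        using r[of n] by simp
      moreover have "(sqrt (2 * pi) / r n) ^ CARD('n) = sqrt (2 * pi) ^ CARD('n) / r n ^ CARD('n)"
        by (rule power_divide)
      ultimately show "r n ^ CARD('n) *\<^sub>R (f (x + r n *\<^sub>R z) * fourier (\<psi> n) (x + r n *\<^sub>R z))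
        = complex_of_real (sqrt (2 * pi) ^ CARD('n)) * (f (x
            + r n *\<^sub>R z) * complex_of_real (gaussian z))"
        using r[of n] unfolding \<psi>(2) by (simp add: scaleR_conv_of_real)
    qed
    finally show ?thesis
      by simp
  qed
  then have "(\<lambda>n. LINT \<xi>|lborel. F \<xi> * \<psi> n \<xi>)
      \<longlonglongrightarrow> complex_of_real (sqrt (2 * pi) ^ CARD('n)) * (f x * complex_of_real (sqrt (2 * pi) ^ CARD('n)))"
    using gaussian_convolution_tendsto[OF f cont] by (simp add: r_def tendsto_mult_left)
  moreover have "complex_of_real (sqrt (2 * pi) ^ CARD('n)) * (z * complex_of_real (sqrt (2 * pi) ^
      CARD('n)))
      = complex_of_real ((2 * pi) ^ CARD('n)) * z" for z
  proof -
    have "(2 * pi) ^ CARD('n) = sqrt (2 * pi) ^ CARD('n) * sqrt (2 * pi) ^ CARD('n)"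
      unfolding power_mult_distrib[symmetric] by simp
    then show ?thesis
      by (simp only: of_real_mult mult.commute mult.left_commute)
  qed
  ultimately show ?thesis
    using LIMSEQ_unique[OF lhs] by metis
qed

subsection \<open>Sobolev functions are Hoelder continuous\<close>

lemma integrable_one_plus_abs_powr:
  assumes "q > 1"
  shows "integrable lborel (\<lambda>t::real. (1 + \<bar>t\<bar>) powr - q)"
proof -
  define g where "g t = indicator {0..} t *\<^sub>R ((1 + t) powr - q)" for t :: real
  let ?F = "\<lambda>t. - ((1 + t) powr (1 - q) / (q - 1))"
  have "(\<integral>\<^sup>+t. ennreal ((1 + t) powr - q) * indicator {0..} t \<partial>lborel) = 0 - ?F 0"
  proof (rule nn_integral_FTC_atLeast)
    show "DERIV ?F t :> (1 + t) powr - q" if "0 \<le> t" for t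
    proof -
      have "((\<lambda>t. (1 + t) powr (1 - q)) has_real_derivative (1 - q) * (1 + t) powr (1 - q - 1)) (at t)"
        using that by (auto intro!: derivative_eq_intros)
      from DERIV_minus[OF DERIV_cdivide[OF this, of "q - 1"]]
      have "DERIV ?F t :> - ((1 - q) * (1 + t) powr (1 - q - 1) / (q - 1))" .
      moreover have "- ((1 - q) * z / (q - 1)) = z" for z
        using assms by (simp add: field_simps)
      ultimately show ?thesis
        by (simp only:) simp
    qed
    have "((\<lambda>t. (1 + t) powr (1 - q)) \<longlongrightarrow> 0) at_top"
      using assms by (intro tendsto_neg_powr filterlim_tendsto_add_at_top[OF tendsto_const
          filterlim_ident]) auto
    then have "(?F \<longlongrightarrow> - (0 / (q - 1))) at_top"
      using assms by (intro tendsto_minus tendsto_divide tendsto_const) auto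
    then show "(?F \<longlongrightarrow> 0) at_top"
      by simp
  qed auto
  moreover have "(\<integral>\<^sup>+t. ennreal (norm (g t)) \<partial>lborel) = (\<integral>\<^sup>+t. ennreal ((1 + t) powr
      - q) * indicator {0..} t \<partial>lborel)"
    by (intro nn_integral_cong) (auto simp: g_def indicator_def)
  moreover have "g \<in> borel_measurable lborel"
    unfolding g_def[abs_def] by measurable
  ultimately have "integrable lborel g"
    by (intro integrableI_bounded) auto
  \<comment> \<open>Reflection covers the negative half-line. The point 0 is counted twice, which is
    harmless for an upper bound.\<close>
  then have "integrable lborel (\<lambda>t. g t + g (0 + (-1) *\<^sub>R t))"
    by (intro Bochner_Integration.integrable_add lborel_integrable_affine) auto
  then show ?thesis
    by (rule Bochner_Integration.integrable_bound) (auto simp: g_def indicator_def)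
qed

lemma integrable_one_plus_square_powr:
  assumes "p > 1 / 2"
  shows "integrable lborel (\<lambda>t::real. (1 + t\<^sup>2) powr - p)"
proof (rule Bochner_Integration.integrable_bound)
  show "integrable lborel (\<lambda>t::real. 2 powr p * (1 + \<bar>t\<bar>) powr - (2 * p))"
    using assms by (intro integrable_mult_right integrable_one_plus_abs_powr) auto
  have "(1 + t\<^sup>2) powr - p \<le> 2 powr p * (1 + \<bar>t\<bar>) powr - (2 * p)" for t :: real
  proof -
    have "(1 + \<bar>t\<bar>)\<^sup>2 / 2 \<le> 1 + t\<^sup>2"
      using sum_squares_bound[of 1 "\<bar>t\<bar>"] by (simp add: power2_sum)
    moreover have "0 < (1 + \<bar>t\<bar>)\<^sup>2 / 2"
      by (simp add: add_pos_nonneg)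
    ultimately have "(1 + t\<^sup>2) powr - p \<le> ((1 + \<bar>t\<bar>)\<^sup>2 / 2) powr - p"
      using assms by (intro powr_mono2') auto
    also have "\<dots> = 2 powr p * ((1 + \<bar>t\<bar>)\<^sup>2) powr - p"
      by (simp add: powr_divide powr_minus field_simps)
    also have "((1 + \<bar>t\<bar>)\<^sup>2) powr - p = (1 + \<bar>t\<bar>) powr - (2 * p)"
      using powr_powr[of "1 + \<bar>t\<bar>" 2 "- p"] by (simp add: powr_numeral add_pos_nonneg)
    finally show ?thesis .
  qed
  then show "AE t in lborel. norm ((1 + t\<^sup>2) powr - p) \<le> norm (2 powr p * (1 + \<bar>t\<bar>) powr - (2 * p))"
    by (simp add: abs_mult)
qed auto

text \<open>Each \<open>1 + (x \<bullet> b)\<^sup>2\<close> is at most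
  \<open>1 + (norm x)\<^sup>2\<close>. Sharing the exponent equally among the coordinates thus
  dominates the weight by a product of one-dimensional functions, and each share exceeds 1/2 exactly
  when \<open>s\<close> exceeds half the dimension. No polar coordinates are involved.\<close>

lemma integrable_sobolev_weight:
  assumes "s > DIM('a::euclidean_space) / 2"
  shows "integrable lborel (\<lambda>x::'a. (1 + (norm x)\<^sup>2) powr - s)"
proof (rule Bochner_Integration.integrable_bound)
  let ?p = "s / DIM('a)"
  have "s > 0"
    using assms by (meson divide_nonneg_nonneg le_less_trans of_nat_0_le_iff zero_le_numeral)
  have p: "?p > 1 / 2"
    using assms by (simp add: field_simps)
  show "integrable lborel (\<lambda>x::'a. \<Prod>b\<in>Basis. (1 + (x \<bullet> b)\<^sup>2) powr - ?p)"
    by (rule lborel_integral_prod_Basis(1)[OF integrable_one_plus_square_powr[OF p]])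
  have "(1 + (norm x)\<^sup>2) powr - s \<le> (\<Prod>b\<in>Basis. (1 + (x \<bullet> b)\<^sup>2) powr - ?p)" for x :: 'a
  proof -
    have "(1 + (norm x)\<^sup>2) powr - s = (\<Prod>b\<in>(Basis::'a set). (1 + (norm x)\<^sup>2) powr - ?p)"
    proof -
      have "1 + (norm x)\<^sup>2 > 0"
        by (simp add: add_pos_nonneg)
      then show ?thesis
        by (simp add: powr_powr flip: powr_realpow)
    qed
    also have "\<dots> \<le> (\<Prod>b\<in>Basis. (1 + (x \<bullet> b)\<^sup>2) powr - ?p)"
    proof (intro prod_mono conjI powr_mono2')
      fix b :: 'a assume "b \<in> Basis"
      then have "\<bar>x \<bullet> b\<bar>\<^sup>2 \<le> (norm x)\<^sup>2"
        by (intro power_mono Basis_le_norm) auto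
      then show "1 + (x \<bullet> b)\<^sup>2 \<le> 1 + (norm x)\<^sup>2"
        by simp
    qed (use \<open>s > 0\<close> in \<open>auto simp: add_pos_nonneg\<close>)
    finally show ?thesis .
  qed
  then show "AE x::'a in lborel. norm ((1 + (norm x)\<^sup>2) powr - s) \<le> norm (\<Prod>b\<in>Basis. (1
      + (x \<bullet> b)\<^sup>2) powr - ?p)"
    by (intro AE_I2) (simp add: prod_nonneg)
qed auto

text \<open>Interpolates between the Lipschitz bound \<open>\<bar>a - b\<bar>\<close>, the better
  one at distances up to 1, and the trivial bound 2.\<close>

lemma norm_iexp_diff_le:
  assumes "0 < \<alpha>" "\<alpha> \<le> 1"
  shows "cmod (iexp a - iexp b) \<le> 2 * \<bar>a - b\<bar> powr \<alpha>"
proof -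
  have "iexp a = iexp b * iexp (a - b)"
    by (simp add: algebra_simps flip: exp_add)
  then have "iexp a - iexp b = iexp b * (iexp (a - b) - 1)"
    by (simp add: algebra_simps)
  then have eq: "cmod (iexp a - iexp b) = cmod (iexp (a - b) - 1)"
    by (simp add: norm_mult)
  show ?thesis
  proof (cases "\<bar>a - b\<bar> \<le> 1")
    case True
    have "cmod (iexp (a - b) - 1) \<le> \<bar>a - b\<bar>"
      using iexp_approx1[of "a - b" 0] by simp
    also have "\<dots> \<le> \<bar>a - b\<bar> powr \<alpha>"
      using powr_mono'[of \<alpha> 1 "\<bar>a - b\<bar>"] True assms by (cases "a = b") auto
    finally show ?thesis
      unfolding eq using powr_ge_zero[of "\<bar>a - b\<bar>" \<alpha>] by linarith
  next
    case False
    then have "1 \<le> \<bar>a - b\<bar> powr \<alpha>"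
      using assms by (intro ge_one_powr_ge_zero) auto
    moreover have "cmod (iexp (a - b) - 1) \<le> 2"
      by (rule order_trans[OF norm_triangle_ineq4]) simp
    ultimately show ?thesis
      unfolding eq by linarith
  qed
qed

theorem sobolev_bounded_hoelder:
  fixes f :: "real ^ 'n \<Rightarrow> complex"
  assumes f: "f \<in> sobolev \<sigma>" and cont: "continuous_on UNIV f"
    and \<alpha>: "0 < \<alpha>" "\<alpha> \<le> 1" "CARD('n) / 2 < \<sigma> - \<alpha>"
  shows "\<exists>B C. (\<forall>x. cmod (f x) \<le> B) \<and> (\<forall>x y. cmod (f x - f y) \<le> C * norm (x - y) powr \<alpha>)"
proof -
  define w :: "real ^ 'n \<Rightarrow> real" where "w \<xi> = 1 + (norm \<xi>)\<^sup>2" for \<xi>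
  have w: "w \<xi> \<ge> 1" for \<xi>
    by (simp add: w_def)
  have [measurable]: "w \<in> borel_measurable borel"
    unfolding w_def[abs_def] by measurable
  obtain F where fF: "has_fourier_L2 f F" and F: "integrable lborel (\<lambda>\<xi>. (cmod (F \<xi>))\<^sup>2 * w \<xi> powr \<sigma>)"
    using f unfolding sobolev_def w_def by auto
  have [measurable]: "F \<in> borel_measurable borel"
    using fF by (simp add: has_fourier_L2_def square_integrable_def)
  have iW: "integrable lborel (\<lambda>\<xi>. cmod (F \<xi>) * w \<xi> powr (\<alpha> / 2))"
  proof (rule Bochner_Integration.integrable_bound)
    have "integrable lborel (\<lambda>\<xi>. w \<xi> powr - (\<sigma> - \<alpha>))"
      unfolding w_def using \<alpha>(3) by (intro integrable_sobolev_weight) simp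
    with F show "integrable lborel (\<lambda>\<xi>. (cmod (F \<xi>))\<^sup>2 * w \<xi> powr \<sigma> + w \<xi> powr - (\<sigma> - \<alpha>))"
      by (rule Bochner_Integration.integrable_add)
    have "cmod (F \<xi>) * w \<xi> powr (\<alpha> / 2) \<le> (cmod (F \<xi>))\<^sup>2 * w \<xi> powr \<sigma> + w \<xi> powr - (\<sigma> - \<alpha>)" for \<xi>
    proof -
      \<comment> \<open>The two factors of the Cauchy-Schwarz argument, used pointwise as
        \<open>u * v \<le> u\<^sup>2 + v\<^sup>2\<close> with both squares integrable.\<close>
      define u v where "u = cmod (F \<xi>) * w \<xi> powr (\<sigma> / 2)" and "v = w \<xi> powr (- (\<sigma> - \<alpha>) / 2)"
      have "u * v = cmod (F \<xi>) * w \<xi> powr (\<alpha> / 2)"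
        by (simp add: u_def v_def mult.assoc flip: powr_add) (simp add: field_simps)
      moreover have "u\<^sup>2 = (cmod (F \<xi>))\<^sup>2 * w \<xi> powr \<sigma>" "v\<^sup>2 = w \<xi> powr - (\<sigma> - \<alpha>)"
        unfolding u_def v_def power_mult_distrib power2_eq_square[of "_ powr _"]
        by (simp_all flip: powr_add)
      moreover have "u * v \<ge> 0"
        by (simp add: u_def v_def)
      ultimately show ?thesis
        using sum_squares_bound[of u v] by linarith
    qed
    then show "AE \<xi> in lborel. norm (cmod (F \<xi>) * w \<xi> powr (\<alpha> / 2))
        \<le> norm ((cmod (F \<xi>))\<^sup>2 * w \<xi> powr \<sigma> + w \<xi> powr - (\<sigma> - \<alpha>))"
      by (intro AE_I2) (simp add: add_nonneg_nonneg)
  qed measurable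
  have iF: "integrable lborel F"
  proof (rule Bochner_Integration.integrable_bound[OF iW])
    have "cmod (F \<xi>) \<le> cmod (F \<xi>) * w \<xi> powr (\<alpha> / 2)" for \<xi>
      using mult_left_mono[OF ge_one_powr_ge_zero[OF w, of "\<alpha> / 2"], of "cmod (F \<xi>)"] \<alpha> by simp
    then show "AE \<xi> in lborel. norm (F \<xi>) \<le> norm (cmod (F \<xi>) * w \<xi> powr (\<alpha> / 2))"
      by (intro AE_I2) simp
  qed simp
  define K where "K = complex_of_real ((2 * pi) ^ CARD('n))"
  define e where "e x \<xi> = exp (\<i> * complex_of_real (x \<bullet> \<xi>))" for x \<xi> :: "real ^ 'n"
  have [measurable]: "e x \<in> borel_measurable borel" for x
    unfolding e_def[abs_def] by measurable
  have K: "cmod K > 0"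
    by (simp add: K_def)
  have inv: "(LINT \<xi>|lborel. F \<xi> * e x \<xi>) = K * f x" for x
    unfolding K_def e_def using cont by (intro fourier_L2_inversion fF iF) (simp add:
        continuous_on_eq_continuous_at)
  have ie: "integrable lborel (\<lambda>\<xi>. F \<xi> * e x \<xi>)" for x
    by (rule integrable_mult_bounded[OF iF, where B = 1]) (auto simp: e_def)
  have bound: "cmod (f x) \<le> (LINT \<xi>|lborel. cmod (F \<xi>)) / cmod K" for x
  proof -
    have "cmod (K * f x) \<le> (LINT \<xi>|lborel. cmod (F \<xi> * e x \<xi>))"
      unfolding inv[symmetric] by (rule integral_norm_bound)
    then show ?thesis
      using K by (simp add: norm_mult e_def field_simps)
  qed
  have hoelder: "cmod (f x - f y) \<le> (2 * (LINT \<xi>|lborel. cmod (F \<xi>) * w \<xi> powr (\<alpha> / 2)) / cmod K) *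
      norm (x - y) powr \<alpha>" for x y
  proof -
    have pt: "cmod (F \<xi> * e x \<xi> - F \<xi> * e y \<xi>) \<le> (2 * norm (x
        - y) powr \<alpha>) * (cmod (F \<xi>) * w \<xi> powr (\<alpha> / 2))" for \<xi>
    proof -
      have "\<bar>x \<bullet> \<xi> - y \<bullet> \<xi>\<bar> \<le> norm (x - y) * norm \<xi>"
        unfolding inner_diff_left[symmetric] by (rule Cauchy_Schwarz_ineq2)
      also have "\<dots> \<le> norm (x - y) * sqrt (w \<xi>)"
        by (intro mult_left_mono real_le_rsqrt) (auto simp: w_def)
      finally have "\<bar>x \<bullet> \<xi> - y \<bullet> \<xi>\<bar> powr \<alpha> \<le> (norm (x - y) * sqrt (w \<xi>)) powr \<alpha>"
        using \<alpha> by (intro powr_mono2) auto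
      also have "\<dots> = norm (x - y) powr \<alpha> * w \<xi> powr (\<alpha> / 2)"
        using w[of \<xi>] by (simp add: powr_mult powr_powr flip: powr_half_sqrt)
      finally have "cmod (e x \<xi> - e y \<xi>) \<le> 2 * (norm (x - y) powr \<alpha> * w \<xi> powr (\<alpha> / 2))"
        unfolding e_def using norm_iexp_diff_le[OF \<alpha>(1,2), of "x \<bullet> \<xi>" "y \<bullet> \<xi>"] by linarith
      then have "cmod (F \<xi>) * cmod (e x \<xi> - e y \<xi>) \<le> cmod (F \<xi>) * (2 * (norm (x
          - y) powr \<alpha> * w \<xi> powr (\<alpha> / 2)))"
        by (intro mult_left_mono) auto
      then show ?thesis
        by (simp add: norm_mult mult_ac flip: right_diff_distrib)
    qed
    have "K * (f x - f y) = (LINT \<xi>|lborel. F \<xi> * e x \<xi> - F \<xi> * e y \<xi>)"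
      unfolding right_diff_distrib inv[symmetric] by (rule Bochner_Integration.integral_diff[OF ie
          ie, symmetric])
    then have "cmod K * cmod (f x - f y) \<le> (LINT \<xi>|lborel. cmod (F \<xi> * e x \<xi> - F \<xi> * e y \<xi>))"
      by (simp only: norm_mult[symmetric] integral_norm_bound)
    also have "\<dots> \<le> (LINT \<xi>|lborel. (2 * norm (x - y) powr \<alpha>) * (cmod (F \<xi>) * w \<xi> powr (\<alpha> / 2)))"
      by (intro integral_mono integrable_norm Bochner_Integration.integrable_diff ie
          integrable_mult_right iW pt)
    also have "\<dots> = (2 * norm (x - y) powr \<alpha>) * (LINT \<xi>|lborel. cmod (F \<xi>) * w \<xi> powr (\<alpha> / 2))"
      by (rule integral_mult_right_zero)
    finally show ?thesis
      using K by (simp add: field_simps)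
  qed
  from bound hoelder show ?thesis
    by blast
qed

subsection \<open>Uniqueness of Fourier coefficients on the torus\<close>

lemma integral_prod_cart:
  fixes f :: "'n::finite \<Rightarrow> real \<Rightarrow> 'b::{real_normed_field,banach,second_countable_topology}"
  assumes "\<And>l. integrable lborel (f l)"
  shows "(LINT x|lborel. (\<Prod>l\<in>UNIV. f l (x $ l))) = (\<Prod>l\<in>UNIV. (LINT t|lborel. f l t))"
proof -
  have "bij_betw (\<lambda>l. axis l (1::real)) UNIV (Basis :: (real ^ 'n) set)"
    unfolding bij_betw_def by (auto simp: inj_on_def axis_eq_axis Basis_vec_def)
  then have R: "(\<Prod>b\<in>(Basis :: (real ^ 'n) set). g b) = (\<Prod>l\<in>UNIV. g (axis l 1))" for g :: "real ^ 'n \<Rightarrow> 'b"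
    by (rule prod.reindex_bij_betw[symmetric])
  show ?thesis
    using lborel_integral_prod_Basis(2)[of "\<lambda>b::real^'n. f (axis_index b)"] assms
    by (simp add: R axis_index_axis inner_axis)
qed

text \<open>Half-open, so that it is an exact fundamental domain: the integer translates tile space
  without overlap.\<close>

definition unit_cube :: "(real ^ 'n) set" where
  "unit_cube = {y. \<forall>l. 0 \<le> y $ l \<and> y $ l < 1}"

lemma integer_points_closed:
  "j \<in> integer_points \<Longrightarrow> k \<in> integer_points \<Longrightarrow> j + k \<in> integer_points"
  "j \<in> integer_points \<Longrightarrow> k \<in> integer_points \<Longrightarrow> j - k \<in> integer_points"
  "k \<in> integer_points \<Longrightarrow> - k \<in> integer_points"
  by (auto simp: integer_points_def)

lemma integer_points_0 [simp]: "0 \<in> integer_points"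
  by (simp add: integer_points_def)

lemma integer_points_axis [simp]: "axis l 1 \<in> integer_points"
  by (simp add: integer_points_def axis_def)

lemma inner_integer_points:
  assumes "j \<in> integer_points" "k \<in> integer_points"
  shows "j \<bullet> k \<in> \<int>"
  using assms unfolding integer_points_def inner_vec_def by (auto intro!: Ints_sum Ints_mult)

lemma unit_cube_translate:
  "\<exists>!j. j \<in> integer_points \<and> x + j \<in> unit_cube"
proof (rule ex1I[where a = "\<chi> l. - of_int \<lfloor>x $ l\<rfloor>"])
  show "(\<chi> l. - of_int \<lfloor>x $ l\<rfloor>) \<in> integer_points \<and> x + (\<chi> l. - of_int \<lfloor>x $ l\<rfloor>) \<in> unit_cube"
    by (auto simp: integer_points_def unit_cube_def) linarith
next
  fix j assume j: "j \<in> integer_points \<and> x + j \<in> unit_cube"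
  show "j = (\<chi> l. - of_int \<lfloor>x $ l\<rfloor>)"
  proof (rule vec_eq_iff[THEN iffD2], rule allI)
    fix l
    obtain m where m: "j $ l = of_int m"
      using j by (auto simp: integer_points_def elim: Ints_cases)
    have "0 \<le> x $ l + of_int m" "x $ l + of_int m < 1"
      using j unfolding unit_cube_def m[symmetric] by auto
    then have "\<lfloor>x $ l\<rfloor> = - m"
      by (intro floor_unique) auto
    then show "j $ l = (\<chi> l. - of_int \<lfloor>x $ l\<rfloor>) $ l"
      by (simp add: m)
  qed
qed

lemma sets_unit_cube [measurable]: "unit_cube \<in> sets borel"
proof -
  have "unit_cube = (\<Inter>l\<in>UNIV. {y. 0 \<le> y $ l} \<inter> {y. y $ l < 1})"
    by (auto simp: unit_cube_def)
  also have "\<dots> \<in> sets borel"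
    by (intro sets.finite_INT sets.Int borel_closed borel_open closed_halfspace_component_ge_cart
        open_halfspace_component_lt_cart) auto
  finally show ?thesis .
qed

lemma unit_cube_subset: "unit_cube \<subseteq> cbox 0 1"
  by (auto simp: unit_cube_def mem_box_cart less_imp_le)

lemma emeasure_unit_cube_finite: "emeasure lborel unit_cube < \<infinity>"
proof -
  have "emeasure lborel (unit_cube :: (real^'n) set) \<le> emeasure lborel (cbox 0 1 :: (real^'n) set)"
    by (intro emeasure_mono unit_cube_subset) auto
  also have "emeasure lborel (cbox 0 1 :: (real^'n) set) < \<infinity>"
    by (simp add: emeasure_lborel_cbox_eq)
  finally show ?thesis .
qed

text \<open>The character of period one in each coordinate. Integrating a function against it
  evaluates \<open>fourier\<close> at \<open>(2 * pi) *\<^sub>R - k\<close>.\<close>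

definition torus_char :: "real ^ 'n \<Rightarrow> real ^ 'n \<Rightarrow> complex" where
  "torus_char k y = cis (2 * pi * (k \<bullet> y))"

lemma torus_char_add: "torus_char (j + k) y = torus_char j y * torus_char k y"
  by (simp add: torus_char_def cis_mult algebra_simps)

lemma cis_2pi_Ints: "m \<in> \<int> \<Longrightarrow> cis (2 * pi * m) = 1"
  by (auto elim!: Ints_cases simp: complex_eq_iff) 

lemma torus_char_translate:
  "j \<in> integer_points \<Longrightarrow> k \<in> integer_points \<Longrightarrow> torus_char k (x + j) = torus_char k x"
  using cis_2pi_Ints[OF inner_integer_points]
  by (simp add: torus_char_def inner_add_right distrib_left flip: cis_mult)

lemma norm_torus_char [simp]: "cmod (torus_char k y) = 1"
  by (simp add: torus_char_def)

lemma continuous_torus_char [continuous_intros]: "continuous_on S (torus_char k)"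
  unfolding torus_char_def[abs_def] by (intro continuous_intros)

lemma borel_measurable_torus_char [measurable]: "torus_char k \<in> borel_measurable borel"
  by (intro borel_measurable_continuous_onI continuous_torus_char)

lemma integrable_unit_cube:
  fixes f :: "real ^ 'n \<Rightarrow> 'b::{banach,second_countable_topology}"
  assumes [measurable]: "f \<in> borel_measurable borel" and "\<And>y. y \<in> unit_cube \<Longrightarrow> norm (f y) \<le> B"
  shows "integrable lborel (\<lambda>y. indicator unit_cube y *\<^sub>R f y)"
proof (rule Bochner_Integration.integrable_bound)
  show "integrable lborel (\<lambda>y::real^'n. B * indicator unit_cube y)"
    using emeasure_unit_cube_finite by (intro integrable_mult_right integrable_real_indicator) auto
  show "AE y in lborel. norm (indicator unit_cube y *\<^sub>R f y) \<le> norm (B * indicator unit_cube y)"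
    using assms(2) by (auto simp: indicator_def intro: order_trans[OF _ abs_ge_self])
qed measurable

text \<open>The integral factors over the coordinates, and any coordinate with
  \<open>k $ l \<noteq> 0\<close> contributes an integral over full periods, which is 0.\<close>

lemma integral_unit_cube_torus_char:
  fixes k :: "real ^ 'n"
  assumes k: "k \<in> integer_points"
  shows "(LINT y|lborel. indicator unit_cube y *\<^sub>R torus_char k y) = (if k = 0 then 1 else 0)"
proof -
  define f where "f l t = indicator {0..<1} t *\<^sub>R cis (2 * pi * (k $ l) * t)" for l t
  \<comment> \<open>The cube is half-open, while the fundamental theorem of calculus is applied on a
    closed interval; only the null set consisting of 1 separates them.\<close>
  have AEeq: "AE t in lborel. f l t = indicator {0..1} t *\<^sub>R cis (2 * pi * (k $ l) * t)" for l
    using AE_lborel_singleton[of "1::real"] by eventually_elim (auto simp: f_def indicator_def)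
  then have AEeq': "AE t in lborel. indicator {0..1} t *\<^sub>R cis (2 * pi * (k $ l) * t) = f l t" for l
    by (simp add: eq_commute)
  have [measurable]: "f l \<in> borel_measurable borel" "(\<lambda>t. indicator {0..1} t *\<^sub>R cis (2 * pi * (k $
      l) * t)) \<in> borel_measurable borel" for l
  proof -
    have [measurable]: "(\<lambda>t. cis (2 * pi * (k $ l) * t)) \<in> borel_measurable borel"
      by (intro borel_measurable_continuous_onI continuous_intros)
    show "f l \<in> borel_measurable borel" "(\<lambda>t. indicator {0..1} t *\<^sub>R cis (2 * pi * (k $ l) * t)) \<in>
        borel_measurable borel"
      unfolding f_def[abs_def] by measurable
  qed
  have "integrable lborel (f l)" for l
  proof (rule integrable_cong_AE_imp[OF _ _ AEeq'])
    show "integrable lborel (\<lambda>t. indicator {0..1} t *\<^sub>R cis (2 * pi * (k $ l) * t))"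
      using borel_integrable_atLeastAtMost'[of 0 1 "\<lambda>t. cis (2 * pi * (k $ l) * t)"]
      unfolding set_integrable_def by (simp add: continuous_intros)
  qed auto
  then have "(LINT y|lborel. (\<Prod>l\<in>UNIV. f l (y $ l))) = (\<Prod>l\<in>UNIV. (LINT t|lborel. f l t))"
    by (rule integral_prod_cart)
  moreover have "(\<Prod>l\<in>UNIV. f l (y $ l)) = indicator unit_cube y *\<^sub>R torus_char k y" for y
  proof -
    have "(\<Prod>l\<in>UNIV. cis (2 * pi * (k $ l) * (y $ l))) = cis (\<Sum>l\<in>UNIV. 2 * pi * (k $ l) * (y $ l))"
      by (simp add: cis_conv_exp exp_sum sum_distrib_left)
    also have "(\<Sum>l\<in>UNIV. 2 * pi * (k $ l) * (y $ l)) = 2 * pi * (k \<bullet> y)"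
      by (simp add: inner_vec_def sum_distrib_left mult.assoc)
    finally show ?thesis
      by (auto simp: f_def torus_char_def unit_cube_def indicator_def prod.distrib scaleR_conv_of_real)
  qed
  moreover have "(LINT t|lborel. f l t) = (if k $ l = 0 then 1 else 0)" for l
  proof -
    have "(LINT t|lborel. f l t) = (LINT t|lborel. indicator {0..1} t *\<^sub>R cis (2 * pi * (k $ l) * t))"
      by (rule integral_cong_AE[OF _ _ AEeq]) auto
    also have "\<dots> = (if k $ l = 0 then 1 else 0)"
    proof (cases "k $ l = 0")
      case False
      define c where "c = 2 * pi * (k $ l)"
      have c: "c \<noteq> 0" "cis c = 1"
        using False k cis_2pi_Ints[of "k $ l"] by (auto simp: c_def integer_points_def)
      have "(LINT t|lborel. indicator {0..1} t *\<^sub>R cis (c * t)) = cis (c * 1) / (\<i> * c)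
          - cis (c * 0) / (\<i> * c)"
      proof (rule integral_FTC_atLeastAtMost)
        fix t :: real
        have "((\<lambda>t. cis (c * t)) has_vector_derivative (\<i> * c) * cis (c * t)) (at t within {0..1})"
        proof -
          have "((\<lambda>z. exp (\<i> * (c * z))) has_field_derivative (\<i> * c) * exp (\<i> * (c * of_real t)))
              (at (of_real t))"
            by (auto intro!: derivative_eq_intros)
          from has_vector_derivative_real_field[OF this] show ?thesis
            by (simp add: cis_conv_exp)
        qed
        from has_vector_derivative_divide[OF this, of "\<i> * c"]
        show "((\<lambda>t. cis (c * t) / (\<i> * c)) has_vector_derivative cis (c * t)) (at t within {0..1})"
          using c(1) by simp
      qed (auto intro!: continuous_intros)
      then show ?thesis
        using False c by (simp add: c_def)
    qed simp
    finally show ?thesis .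
  qed
  ultimately show ?thesis
    by (auto simp: vec_eq_iff intro!: prod_zero)
qed


text \<open>\<open>Q\<close> is orthogonal to all trigonometric polynomials, and these approximate
  it uniformly, so it is orthogonal to itself. Stone-Weierstrass needs a compact set with separated
  points, so \<open>Q\<close> is moved to the torus of vectors in \<open>complex ^ 'n\<close> with
  unimodular entries. Its real form is applied, with the real and imaginary parts of the coordinates
  separating the points.\<close>

lemma torus_uniqueness:
  fixes Q :: "real ^ 'n \<Rightarrow> real"
  assumes cont: "continuous_on UNIV Q"
    and per: "\<And>k y. k \<in> integer_points \<Longrightarrow> Q (y + k) = Q y"
    and coeff: "\<And>k. k \<in> integer_points \<Longrightarrow>
      (LINT y|lborel. indicator unit_cube y *\<^sub>R (complex_of_real (Q y) * torus_char k y)) = 0"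
  shows "Q y = 0"
proof -
  \<comment> \<open>\<open>E\<close> is the quotient map onto the torus \<open>K\<close>, and
    \<open>L\<close> picks a preimage by principal arguments.\<close>
  define E :: "real ^ 'n \<Rightarrow> complex ^ 'n" where "E y = (\<chi> l. cis (2 * pi * (y $ l)))" for y
  define L :: "complex ^ 'n \<Rightarrow> real ^ 'n" where "L z = (\<chi> l. Arg (z $ l) / (2 * pi))" for z
  define K :: "(complex ^ 'n) set" where "K = {z. \<forall>l. cmod (z $ l) = 1}"
  have E: "continuous_on S E" for S
    unfolding E_def[abs_def] by (intro continuous_intros)
  have EK: "E y \<in> K" for y
    by (simp add: E_def K_def)
  have EL: "E (L z) = z" if "z \<in> K" for z
  proof -
    have "cis (Arg (z $ l)) = z $ l" for l
    proof -
      have "cmod (z $ l) = 1"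
        using that by (simp add: K_def)
      moreover from this have "z $ l \<noteq> 0"
        by (metis norm_zero zero_neq_one)
      ultimately show ?thesis
        by (simp add: cis_Arg sgn_div_norm)
    qed
    then show ?thesis
      by (simp add: E_def L_def vec_eq_iff)
  qed
  have L: "L z \<in> cbox (-1) 1" for z
  proof -
    have "- 1 \<le> Arg (z $ l) / (2 * pi) \<and> Arg (z $ l) / (2 * pi) \<le> 1" for l
    proof -
      have "- (2 * pi) \<le> Arg (z $ l)" "Arg (z $ l) \<le> 2 * pi"
        using Arg_bounded[of "z $ l"] pi_gt_zero by linarith+
      then show ?thesis
        by (simp add: field_simps)
    qed
    then show ?thesis
      by (simp add: L_def mem_box_cart)
  qed
  have QE: "Q x = Q y" if "E x = E y" for x y
  proof -
    have "x $ l - y $ l \<in> \<int>" for l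
    proof -
      have "cis (2 * pi * (x $ l)) = cis (2 * pi * (y $ l))"
        using that by (simp add: E_def vec_eq_iff)
      then obtain n where "2 * pi * (x $ l) = 2 * pi * (y $ l) + 2 * pi * real_of_int n"
        using sin_cos_eq_iff[of "2 * pi * (x $ l)" "2 * pi * (y $ l)"] by (auto simp: complex_eq_iff)
      then have "2 * pi * (x $ l - y $ l - real_of_int n) = 0"
        by (simp add: algebra_simps)
      then have "x $ l - y $ l = real_of_int n"
        by simp
      then show ?thesis
        by simp
    qed
    then have "x - y \<in> integer_points"
      by (simp add: integer_points_def)
    from per[OF this, of y] show ?thesis
      by simp
  qed
  have K_image: "K = E ` cbox (-1) 1"
    using EK EL[symmetric] L by blast
  have K: "compact K"
    unfolding K_image by (intro compact_continuous_image E compact_cbox)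
  define q where "q z = Q (L z)" for z
  have qE: "q (E y) = Q y" for y
    unfolding q_def by (rule QE) (simp add: EL EK)
  \<comment> \<open>\<open>L\<close> jumps where an argument reaches \<open>pi\<close>, so
    continuity of \<open>q\<close> is not a matter of composition. A closed set pulls back under
    \<open>q\<close> to the image under \<open>E\<close> of a compact set, which is closed.\<close>
  have q: "continuous_on K q"
  proof (subst continuous_on_closed_vimage)
    show "closed K"
      using K by (rule compact_imp_closed)
    show "\<forall>B. closed B \<longrightarrow> closed (q -` B \<inter> K)"
    proof (intro allI impI)
      fix B :: "real set" assume B: "closed B"
      have "q -` B \<inter> K = E ` (cbox (-1) 1 \<inter> Q -` B)"
        unfolding K_image using qE by auto
      moreover have "closed (cbox (-1) 1 \<inter> Q -` B)"
        using continuous_closed_preimage[OF cont closed_UNIV B] by (intro closed_Int closed_cbox) simp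
      then have "compact (cbox (-1) 1 \<inter> Q -` B)"
        using compact_Int_closed[OF compact_cbox, of "Q
            -` B" "-1" 1] continuous_closed_preimage[OF cont closed_UNIV B]
        by simp
      ultimately show "closed (q -` B \<inter> K)"
        by (simp add: compact_imp_closed compact_continuous_image E)
    qed
  qed
  \<comment> \<open>All functions with vanishing coefficients are taken rather than \<open>Q\<close>
    alone, so that the multipliers preserving the set are closed under products. Boundedness makes
    the integrals over the cube exist.\<close>
  define N :: "(real ^ 'n \<Rightarrow> complex) set" where
    "N = {h. h \<in> borel_measurable borel \<and> (\<exists>B. \<forall>y. cmod (h y) \<le> B) \<and>
      (\<forall>k\<in>integer_points. (LINT y|lborel. indicator unit_cube y *\<^sub>R (h y * torus_char k y)) = 0)}"
  have N_int: "integrable lborel (\<lambda>y. indicator unit_cube y *\<^sub>R (h y * torus_char k y))"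
      if h: "h \<in> N" for h k
  proof -
    obtain B where B: "\<And>y. cmod (h y) \<le> B" and [measurable]: "h \<in> borel_measurable borel"
      using h by (auto simp: N_def)
    show ?thesis
      by (rule integrable_unit_cube[where B = B]) (auto simp: norm_mult B)
  qed
  have N_add: "(\<lambda>y. a * h y + b * h' y) \<in> N" if h: "h \<in> N" and h': "h' \<in> N" for a b h h'
    unfolding N_def
  proof (intro CollectI conjI ballI)
    obtain B B' where B: "\<And>y. cmod (h y) \<le> B" "\<And>y. cmod (h' y) \<le> B'"
      using h h' by (auto simp: N_def)
    have "cmod (a * h y + b * h' y) \<le> cmod a * B + cmod b * B'" for y
      using B by (intro order_trans[OF norm_triangle_ineq] add_mono) (auto simp: norm_mult intro:
          mult_left_mono)
    then show "\<exists>B. \<forall>y. cmod (a * h y + b * h' y) \<le> B"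
      by blast
    show "(\<lambda>y. a * h y + b * h' y) \<in> borel_measurable borel"
      using h h' by (auto simp: N_def)
    fix k :: "real ^ 'n" assume k: "k \<in> integer_points"
    have "indicator unit_cube y *\<^sub>R ((a * h y + b * h' y) * torus_char k y)
      = a * (indicator unit_cube y *\<^sub>R (h y * torus_char k y))
          + b * (indicator unit_cube y *\<^sub>R (h' y * torus_char k y))" for y
      by (simp add: algebra_simps)
    then have "(LINT y|lborel. indicator unit_cube y *\<^sub>R ((a * h y + b * h' y) * torus_char k y))
      = (LINT y|lborel. a * (indicator unit_cube y *\<^sub>R (h y * torus_char k y))
          + b * (indicator unit_cube y *\<^sub>R (h' y * torus_char k y)))"
      by (simp only:)
    also have "\<dots> = a * (LINT y|lborel. indicator unit_cube y *\<^sub>R (h y * torus_char k y))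
        + b * (LINT y|lborel. indicator unit_cube y *\<^sub>R (h' y * torus_char k y))"
      by (subst Bochner_Integration.integral_add)
        (intro integrable_mult_right N_int h h' | simp only: integral_mult_right_zero)+
    also have "\<dots> = 0"
      using h h' k by (simp add: N_def)
    finally show "(LINT y|lborel. indicator unit_cube y *\<^sub>R ((a * h y + b * h' y) * torus_char k y))
        = 0" .
  qed
  have N_char: "(\<lambda>y. torus_char j y * h y) \<in> N" if h: "h \<in> N" and j: "j \<in> integer_points" for h j
  proof -
    have eq: "torus_char j y * h y * torus_char k y = h y * torus_char (j + k) y" for k y
      by (simp add: torus_char_add)
    show ?thesis
      using h integer_points_closed(1)[OF j] unfolding N_def mem_Collect_eq eq
      by (auto simp: norm_mult)
  qed
  \<comment> \<open>Multiplication by a trigonometric polynomial preserves the vanishing of all Fourier coefficients,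
    and the functions with this property form an algebra.\<close>
  define R where "R = {r. continuous_on UNIV r \<and> (\<forall>h\<in>N. (\<lambda>y. complex_of_real (r (E y)) * h y) \<in> N)}"
  have N_lin: "(\<lambda>y. (a * torus_char (axis l 1) y + b * torus_char (- axis l 1) y) * h y) \<in> N"
      if "h \<in> N" for a b h l
    using N_add[OF N_char N_char, of h "axis l 1" h "- axis l 1" a b] that
    by (simp add: distrib_right mult.assoc integer_points_closed(3)[OF integer_points_axis])
  have cos_sin: "(\<lambda>z. Re (z $ l)) \<in> R" "(\<lambda>z. Im (z $ l)) \<in> R" for l
  proof -
    have cs: "cis (2 * pi * (y $ l)) = torus_char (axis l 1) y" "cis (- (2 * pi * (y $ l)))
        = torus_char (- axis l 1) y" for y
      by (simp_all add: torus_char_def inner_axis')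
    have "complex_of_real (Re (E y $ l)) = 1 / 2 * torus_char (axis l 1) y
        + 1 / 2 * torus_char (- axis l 1) y" for y
      unfolding cs[symmetric] by (simp add: E_def complex_eq_iff)
    then show "(\<lambda>z. Re (z $ l)) \<in> R"
      unfolding R_def using N_lin[where a = "1 / 2" and b = "1 / 2" and l = l]
      by (auto intro!: continuous_intros)
    have "complex_of_real (Im (E y $ l)) = - (\<i> / 2) * torus_char (axis l 1) y
        + (\<i> / 2) * torus_char (- axis l 1) y" for y
      unfolding cs[symmetric] by (simp add: E_def complex_eq_iff)
    then show "(\<lambda>z. Im (z $ l)) \<in> R"
      unfolding R_def using N_lin[where a = "- (\<i> / 2)" and b = "\<i> / 2" and l = l]
      by (auto intro!: continuous_intros)
  qed
  interpret function_ring_on R K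
  proof
    show "compact K" by (rule K)
    show "continuous_on K r" if "r \<in> R" for r
      using that continuous_on_subset by (auto simp: R_def)
    show "(\<lambda>z. r z + r' z) \<in> R" if "r \<in> R" "r' \<in> R" for r r'
      unfolding R_def
    proof (intro CollectI conjI ballI)
      fix h assume "h \<in> N"
      then show "(\<lambda>y. complex_of_real (r (E y) + r' (E y)) * h y) \<in> N"
        using N_add[of "\<lambda>y. complex_of_real (r (E y)) * h y" "\<lambda>y. complex_of_real (r' (E y)) * h y"
            1 1] that
        by (simp add: R_def distrib_right)
    qed (use that in \<open>auto simp: R_def intro: continuous_on_add\<close>)
    show "(\<lambda>z. r z * r' z) \<in> R" if "r \<in> R" "r' \<in> R" for r r'
      using that by (auto simp: R_def mult.assoc intro: continuous_on_mult)
    show "(\<lambda>_. c) \<in> R" for c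
      using N_add[where b = 0] by (auto simp: R_def)
    show "\<exists>r\<in>R. r x \<noteq> r y" if xy: "x \<noteq> y" for x y
    proof -
      obtain l where "Re (x $ l) \<noteq> Re (y $ l) \<or> Im (x $ l) \<noteq> Im (y $ l)"
        using xy by (auto simp: vec_eq_iff complex_eq_iff)
      then show ?thesis
        using cos_sin[of l] by (elim disjE bexI[rotated])
    qed
  qed
  have [measurable]: "Q \<in> borel_measurable borel"
    using cont by (rule borel_measurable_continuous_onI)
  have "compact (q ` K)"
    by (intro compact_continuous_image q K)
  then obtain B where B: "\<And>z. z \<in> K \<Longrightarrow> \<bar>q z\<bar> \<le> B"
    using compact_imp_bounded[of "q ` K"] unfolding bounded_iff by auto
  then have QB: "\<bar>Q y\<bar> \<le> B" for y
    using EK[of y] by (metis qE)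
  then have QN: "(\<lambda>y. complex_of_real (Q y)) \<in> N"
    using coeff by (auto simp: N_def)
  have Q2: "integrable lborel (\<lambda>y. indicator unit_cube y *\<^sub>R (Q y * Q y))"
  proof (rule integrable_unit_cube[where B = "B * B"])
    show "norm (Q y * Q y) \<le> B * B" for y
      unfolding real_norm_def abs_mult
      by (intro mult_mono QB abs_ge_zero order_trans[OF abs_ge_zero QB])
  qed measurable
  \<comment> \<open>For \<open>r\<close> in \<open>R\<close>, \<open>r (E y) * Q y\<close> has zero
    integral over the cube, its coefficient at frequency 0. Hence \<open>Q y * Q y\<close> may be
    replaced by \<open>(Q y - r (E y)) * Q y\<close>, which is at most \<open>\<epsilon> * B\<close>
    when \<open>r\<close> is an \<epsilon>-approximation of \<open>q\<close>.\<close>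
  have small: "(LINT y|lborel. indicator unit_cube y *\<^sub>R (Q y * Q y))
      \<le> \<epsilon> * B * (LINT y|lborel. indicator unit_cube (y::real^'n))" if "\<epsilon> > 0" for \<epsilon>
  proof -
    obtain r where r: "r \<in> R" and rq: "\<And>z. z \<in> K \<Longrightarrow> \<bar>q z - r z\<bar> < \<epsilon>"
      using Stone_Weierstrass_basic[OF q \<open>\<epsilon> > 0\<close>] by auto
    have rN: "(\<lambda>y. complex_of_real (r (E y)) * complex_of_real (Q y)) \<in> N"
      using r QN by (simp add: R_def)
    have ir: "integrable lborel (\<lambda>y. indicator unit_cube y *\<^sub>R (r (E y) * Q y))"
      and r0: "(LINT y|lborel. indicator unit_cube y *\<^sub>R (r (E y) * Q y)) = 0"
    proof -
      have eq: "indicator unit_cube y *\<^sub>R (complex_of_real (r (E y)) * complex_of_real (Q y) *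
          torus_char 0 y)
         = complex_of_real (indicator unit_cube y *\<^sub>R (r (E y) * Q y))" for y
        by (simp add: torus_char_def scaleR_conv_of_real)
      have "integrable lborel (\<lambda>y. complex_of_real (indicator unit_cube y *\<^sub>R (r (E y) * Q y)))"
        using N_int[OF rN, of 0] unfolding eq .
      from integrable_Re[OF this] show "integrable lborel (\<lambda>y. indicator unit_cube y *\<^sub>R (r (E y) *
          Q y))"
        by simp
      have "(LINT y|lborel. complex_of_real (indicator unit_cube y *\<^sub>R (r (E y) * Q y))) = 0"
        using rN unfolding N_def eq[symmetric] by auto
      then show "(LINT y|lborel. indicator unit_cube y *\<^sub>R (r (E y) * Q y)) = 0"
        by (simp only: integral_complex_of_real of_real_eq_0_iff)
    qed
    have "(LINT y|lborel. indicator unit_cube y *\<^sub>R (Q y * Q y))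
       = (LINT y|lborel. indicator unit_cube y *\<^sub>R (Q y * Q y)
           - indicator unit_cube y *\<^sub>R (r (E y) * Q y))"
      by (subst Bochner_Integration.integral_diff[OF Q2 ir]) (simp only: r0 diff_zero)
    also have "\<dots> \<le> (LINT y|lborel. \<epsilon> * B * indicator unit_cube (y::real^'n))"
    proof (rule integral_mono)
      show "integrable lborel (\<lambda>y::real^'n. \<epsilon> * B * indicator unit_cube y)"
        using emeasure_unit_cube_finite by (intro integrable_mult_right integrable_real_indicator) auto
      fix y :: "real ^ 'n"
      have "(Q y - r (E y)) * Q y \<le> \<bar>Q y - r (E y)\<bar> * \<bar>Q y\<bar>"
        by (metis abs_ge_self abs_mult)
      also have "\<dots> \<le> \<epsilon> * B"
        using rq[OF EK, of y] QB[of y] that by (intro mult_mono) (auto simp: qE)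
      finally show "indicator unit_cube y *\<^sub>R (Q y * Q y) - indicator unit_cube y *\<^sub>R (r (E y) * Q y)
          \<le> \<epsilon> * B * indicator unit_cube y"
        by (auto simp: indicator_def left_diff_distrib)
    qed (intro Bochner_Integration.integrable_diff Q2 ir)
    finally show ?thesis
      by simp
  qed
  have "(LINT y|lborel. indicator unit_cube y *\<^sub>R (Q y * Q y)) \<le> 0"
  proof (rule tendsto_lowerbound)
    show "((\<lambda>\<epsilon>. \<epsilon> * B * (LINT y|lborel. indicator unit_cube (y::real^'n))) \<longlongrightarrow> 0) (at_right 0)"
      by (auto intro!: tendsto_eq_intros)
    show "\<forall>\<^sub>F \<epsilon> in at_right 0. (LINT y|lborel. indicator unit_cube y *\<^sub>R (Q y * Q y))
        \<le> \<epsilon> * B * (LINT y|lborel. indicator unit_cube (y::real^'n))"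
      using small eventually_at_right_less[of "0::real"] by (auto elim: eventually_mono)
  qed simp
  then have "(LINT y|lborel. indicator unit_cube y *\<^sub>R (Q y * Q y)) = 0"
    by (intro antisym integral_nonneg_AE) (auto simp: indicator_def)
  then have "AE y in lborel. indicator unit_cube y *\<^sub>R (Q y * Q y) = 0"
    by (subst (asm) integral_nonneg_eq_0_iff_AE[OF Q2]) (auto simp: indicator_def)
  \<comment> \<open>From almost everywhere to everywhere: the part of the open box where
    \<open>Q\<close> is nonzero is open and negligible, hence empty. Closure gives the closed box
    and periodicity the whole space.\<close>
  then have "AE y in lborel. y \<in> box 0 1 \<longrightarrow> Q y = 0"
    by eventually_elim (auto simp: indicator_def unit_cube_def mem_box_cart split: if_splits intro:
        less_imp_le)
  then have AE: "AE y in lborel. y \<notin> {y \<in> box 0 1. Q y \<noteq> 0}"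
    by eventually_elim auto
  have op: "open {y \<in> box 0 1. Q y \<noteq> 0}"
  proof -
    have "{y \<in> box 0 1. Q y \<noteq> 0} = box 0 1 \<inter> Q -` (- {0})"
      by auto
    then show ?thesis
      using continuous_open_preimage[OF cont open_UNIV, of "- {0}"] by (auto intro!: open_Int open_box)
  qed
  then have "{y \<in> box 0 1. Q y \<noteq> 0} \<in> null_sets lborel"
    using AE AE_iff_null_sets[of "{y \<in> box 0 1. Q y \<noteq> 0}" lborel] by simp
  then have "negligible {y \<in> box 0 1. Q y \<noteq> 0}"
    by (simp add: negligible_iff_null_sets null_sets_completionI)
  with op have "{y \<in> box 0 1. Q y \<noteq> 0} = {}"
    using open_not_negligible by blast
  then have "Q ` box 0 1 \<subseteq> {0}"
    by auto
  then have closure: "Q ` closure (box 0 1) \<subseteq> {0}"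
    using cont by (intro image_closure_subset) (auto intro: continuous_on_subset)
  have "box 0 (1 :: real^'n) \<noteq> {}"
    by (simp add: interval_ne_empty_cart)
  then have *: "Q x = 0" if "x \<in> cbox 0 1" for x
    using closure that by (auto simp: closure_box)
  obtain j where "j \<in> integer_points" "y + j \<in> unit_cube"
    using unit_cube_translate[of y] by auto
  with *[of "y + j"] unit_cube_subset per show ?thesis
    by auto
qed

subsection \<open>Partition of unity\<close>

lemma finite_integer_points_cbox: "finite (integer_points \<inter> cbox a b)"
proof (rule finite_subset)
  let ?S = "PiE UNIV (\<lambda>l. {\<lfloor>a $ l\<rfloor>..\<lceil>b $ l\<rceil>})"
  show "finite ((\<lambda>g. \<chi> l. real_of_int (g l)) ` ?S)"
    by (intro finite_imageI finite_PiE) auto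
  show "integer_points \<inter> cbox a b \<subseteq> (\<lambda>g. \<chi> l. real_of_int (g l)) ` ?S"
  proof
    fix k assume k: "k \<in> integer_points \<inter> cbox a b"
    have "k = (\<chi> l. real_of_int \<lfloor>k $ l\<rfloor>)"
      using k by (auto simp: vec_eq_iff integer_points_def)
    moreover have "(\<lambda>l. \<lfloor>k $ l\<rfloor>) \<in> ?S"
    proof -
      have "\<lfloor>a $ l\<rfloor> \<le> \<lfloor>k $ l\<rfloor>" "\<lfloor>k $ l\<rfloor> \<le> \<lceil>b $ l\<rceil>" for l
      proof -
        have "a $ l \<le> k $ l" "k $ l \<le> b $ l"
          using k by (auto simp: mem_box_cart)
        then show "\<lfloor>a $ l\<rfloor> \<le> \<lfloor>k $ l\<rfloor>" "\<lfloor>k $ l\<rfloor> \<le> \<lceil>b $ l\<rceil>"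
          by (auto intro: floor_mono) linarith
      qed
      then show ?thesis
        by auto
    qed
    ultimately show "k \<in> (\<lambda>g. \<chi> l. real_of_int (g l)) ` ?S"
      by (rule image_eqI)
  qed
qed

text \<open>The index set depends on \<open>y\<close> and is finite, so no convergence question
  arises. It captures all translates when \<open>p\<close> vanishes off
  \<open>cbox 0 M\<close>.\<close>

definition periodization :: "real ^ 'n \<Rightarrow> (real ^ 'n \<Rightarrow> real) \<Rightarrow> real ^ 'n \<Rightarrow> real" where
  "periodization M p y = (\<Sum>k | k \<in> integer_points \<and> y - k \<in> cbox 0 M. p (y - k))"

text \<open>Trades the index set depending on \<open>y\<close> for any finite superset: a locally
  constant one for continuity, one for the whole cube for the coefficients, and
  \<open>Lambda\<close> for the approximant.\<close>

lemma periodization_eq_sum: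
  assumes supp: "\<forall>x. x \<notin> cbox 0 M \<longrightarrow> p x = 0"
    and fin: "finite F" and F: "F \<subseteq> integer_points"
    and sub: "\<And>k. k \<in> integer_points \<Longrightarrow> y - k \<in> cbox 0 M \<Longrightarrow> k \<in> F"
  shows "periodization M p y = (\<Sum>k\<in>F. p (y - k))"
  unfolding periodization_def using F sub by (intro sum.mono_neutral_left fin) (use supp in auto)

lemma periodization_eq_sum_cbox:
  assumes "\<forall>x. x \<notin> cbox 0 M \<longrightarrow> p x = 0" and "y \<in> cbox u v"
  shows "periodization M p y = (\<Sum>k\<in>integer_points \<inter> cbox (u - M) v. p (y - k))"
proof (rule periodization_eq_sum)
  fix k assume k: "k \<in> integer_points" "y - k \<in> cbox 0 M"
  have "u $ l - M $ l \<le> k $ l \<and> k $ l \<le> v $ l" for l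
  proof -
    have "0 \<le> y $ l - k $ l" "y $ l - k $ l \<le> M $ l" "u $ l \<le> y $ l" "y $ l \<le> v $ l"
      using k(2) assms(2) by (simp_all add: mem_box_cart)
    then show ?thesis
      by linarith
  qed
  with k(1) show "k \<in> integer_points \<inter> cbox (u - M) v"
    by (simp add: mem_box_cart)
qed (use assms(1) in \<open>auto simp: finite_integer_points_cbox\<close>)

lemma periodization_translate:
  assumes m: "m \<in> integer_points"
  shows "periodization M p (y + m) = periodization M p y"
  unfolding periodization_def
  by (rule sum.reindex_bij_witness[of _ "\<lambda>k. k + m" "\<lambda>k. k - m"])
    (use m in \<open>auto simp: integer_points_closed algebra_simps\<close>)

lemma continuous_periodization:
  assumes "\<forall>x. x \<notin> cbox 0 M \<longrightarrow> p x = 0" and p: "continuous_on UNIV p"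
  shows "continuous_on UNIV (periodization M p)"
proof -
  have "isCont (periodization M p) y" for y
  proof -
    let ?F = "integer_points \<inter> cbox (y - 1 - M) (y + 1)"
    have "\<forall>\<^sub>F x in nhds y. x \<in> box (y - 1) (y + 1)"
      by (intro eventually_nhds_in_open open_box) (simp add: mem_box_cart)
    then have "\<forall>\<^sub>F x in nhds y. periodization M p x = (\<Sum>k\<in>?F. p (x - k))"
      by eventually_elim (intro periodization_eq_sum_cbox assms(1), use box_subset_cbox in auto)
    moreover have "isCont (\<lambda>x. \<Sum>k\<in>?F. p (x - k)) y"
    proof -
      have "continuous_on UNIV (\<lambda>x. \<Sum>k\<in>?F. p (x - k))"
        by (intro continuous_on_sum continuous_on_compose2[OF p] continuous_intros) auto
      then show ?thesis
        by (simp add: continuous_on_eq_continuous_at)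
    qed
    ultimately show ?thesis
      by (subst isCont_cong)
  qed
  then show ?thesis
    by (simp add: continuous_on_eq_continuous_at)
qed

lemma continuous_compact_support_bounded:
  fixes p :: "real ^ 'n \<Rightarrow> 'b::real_normed_vector"
  assumes supp: "\<forall>x. x \<notin> cbox a b \<longrightarrow> p x = 0" and p: "continuous_on UNIV p"
  obtains B where "0 \<le> B" "\<And>x. norm (p x) \<le> B"
proof -
  have "compact (p ` cbox a b)"
    using p by (intro compact_continuous_image) (auto intro: continuous_on_subset)
  then obtain B where B: "\<And>x. x \<in> cbox a b \<Longrightarrow> norm (p x) \<le> B"
    using compact_imp_bounded[of "p ` cbox a b"] unfolding bounded_iff by auto
  have "norm (p x) \<le> max B 0" for x
    using B[of x] supp by (cases "x \<in> cbox a b") auto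
  then show ?thesis
    using that[of "max B 0"] by auto
qed

lemma continuous_compact_support_integrable:
  fixes p :: "real ^ 'n \<Rightarrow> 'b::{banach,second_countable_topology}"
  assumes supp: "\<forall>x. x \<notin> cbox a b \<longrightarrow> p x = 0" and p: "continuous_on UNIV p"
  shows "integrable lborel p"
proof -
  have "integrable lborel (\<lambda>x. indicator (cbox a b) x *\<^sub>R p x)"
    using p by (intro borel_integrable_compact) (auto intro: continuous_on_subset)
  moreover have "indicator (cbox a b) x *\<^sub>R p x = p x" for x
    using supp by (auto simp: indicator_def)
  ultimately show ?thesis
    by simp
qed

text \<open>Unfolding: since \<open>torus_char k\<close> is periodic, each summand becomes an
  integral over a translate of the cube, and these translates tile space.\<close>

lemma periodization_fourier_coeff:
  fixes p :: "real ^ 'n \<Rightarrow> real"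
  assumes supp: "\<forall>x. x \<notin> cbox 0 M \<longrightarrow> p x = 0" and p: "continuous_on UNIV p"
    and k: "k \<in> integer_points"
  shows "(LINT y|lborel. indicator unit_cube y *\<^sub>R (complex_of_real (periodization M p y) *
      torus_char k y))
    = (LINT x|lborel. complex_of_real (p x) * torus_char k x)"
proof -
  \<comment> \<open>This set serves twice: it contains every translate contributing on the cube, and
    for \<open>x\<close> in \<open>cbox 0 M\<close> it contains the unique integer point that moves
    \<open>x\<close> into the cube.\<close>
  let ?F = "integer_points \<inter> cbox (0 - M) 1"
  have [measurable]: "p \<in> borel_measurable borel"
    using p by (rule borel_measurable_continuous_onI)
  obtain B where B: "\<And>x. \<bar>p x\<bar> \<le> B"
    using continuous_compact_support_bounded[OF supp p] unfolding real_norm_def by blast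
  have int: "integrable lborel (\<lambda>y. indicator unit_cube y *\<^sub>R (complex_of_real (p (y
      - j)) * torus_char k y))" for j
    by (rule integrable_unit_cube[where B = B]) (auto simp: norm_mult B)
  have int': "integrable lborel (\<lambda>x. indicator unit_cube (x
      + j) *\<^sub>R (complex_of_real (p x) * torus_char k x))" if "j \<in> ?F" for j
    using lborel_integrable_affine[OF _ int[of j], of 1 j] that k
        by (simp add: torus_char_translate add.commute)
  have "(LINT y|lborel. indicator unit_cube y *\<^sub>R (complex_of_real (periodization M p y) *
      torus_char k y))
    = (LINT y|lborel. (\<Sum>j\<in>?F. indicator unit_cube y *\<^sub>R (complex_of_real (p (y - j)) * torus_char k y)))"
  proof (intro Bochner_Integration.integral_cong refl)
    fix y
    show "indicator unit_cube y *\<^sub>R (complex_of_real (periodization M p y) * torus_char k y)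
      = (\<Sum>j\<in>?F. indicator unit_cube y *\<^sub>R (complex_of_real (p (y - j)) * torus_char k y))"
    proof (cases "y \<in> unit_cube")
      case True
      then have "y \<in> cbox 0 1"
        using unit_cube_subset by auto
      from periodization_eq_sum_cbox[OF supp this] show ?thesis
        using True by (simp add: sum_distrib_right)
    qed simp
  qed
  also have "\<dots> = (\<Sum>j\<in>?F. (LINT y|lborel. indicator unit_cube y *\<^sub>R (complex_of_real (p (y
      - j)) * torus_char k y)))"
    by (intro Bochner_Integration.integral_sum int)
  also have "\<dots> = (\<Sum>j\<in>?F. (LINT x|lborel. indicator unit_cube (x
      + j) *\<^sub>R (complex_of_real (p x) * torus_char k x)))"
  proof (intro sum.cong refl)
    fix j assume "j \<in> ?F"
    then show "(LINT y|lborel. indicator unit_cube y *\<^sub>R (complex_of_real (p (y - j)) * torus_char k y))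
      = (LINT x|lborel. indicator unit_cube (x + j) *\<^sub>R (complex_of_real (p x) * torus_char k x))"
      using k by (subst lborel_integral_affine[of 1 _ j]) (simp_all add: torus_char_translate
          add.commute[of j])
  qed
  also have "\<dots> = (LINT x|lborel. (\<Sum>j\<in>?F. indicator unit_cube (x
      + j) *\<^sub>R (complex_of_real (p x) * torus_char k x)))"
    by (rule Bochner_Integration.integral_sum[symmetric]) (rule int')
  also have "\<dots> = (LINT x|lborel. complex_of_real (p x) * torus_char k x)"
  proof (intro Bochner_Integration.integral_cong refl)
    fix x
    show "(\<Sum>j\<in>?F. indicator unit_cube (x + j) *\<^sub>R (complex_of_real (p x) * torus_char k x))
        = complex_of_real (p x) * torus_char k x"
    proof (cases "p x = 0")
      case False
      then have x: "x \<in> cbox 0 M"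
        using supp by blast
      obtain j where j: "j \<in> integer_points" "x + j \<in> unit_cube"
        and uniq: "\<And>i. i \<in> integer_points \<Longrightarrow> x + i \<in> unit_cube \<Longrightarrow> i = j"
        using unit_cube_translate[of x] by blast
      have "- (M $ l) \<le> j $ l \<and> j $ l \<le> 1" for l
      proof -
        have "0 \<le> x $ l" "x $ l \<le> M $ l" "0 \<le> x $ l + j $ l" "x $ l + j $ l < 1"
          using x j(2) by (simp_all add: mem_box_cart unit_cube_def)
        then show ?thesis
          by linarith
      qed
      then have "j \<in> ?F"
        using j(1) by (simp add: mem_box_cart)
      have "(\<Sum>i\<in>?F. indicator unit_cube (x + i) *\<^sub>R (complex_of_real (p x) * torus_char k x))
        = (\<Sum>i\<in>?F. if i = j then complex_of_real (p x) * torus_char k x else 0)"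
      proof (rule sum.cong[OF refl])
        fix i assume "i \<in> ?F"
        then have "x + i \<in> unit_cube \<longleftrightarrow> i = j"
          using uniq[of i] j by blast
        then show "indicator unit_cube (x + i) *\<^sub>R (complex_of_real (p x) * torus_char k x)
          = (if i = j then complex_of_real (p x) * torus_char k x else 0)"
          by (simp add: indicator_def)
      qed
      also have "\<dots> = complex_of_real (p x) * torus_char k x"
        using \<open>j \<in> ?F\<close> by (subst sum.delta[OF finite_integer_points_cbox]) (simp only: if_True)
      finally show ?thesis .
    qed simp
  qed
  finally show ?thesis .
qed

theorem periodization_eq_1:
  fixes p :: "real ^ 'n \<Rightarrow> real"
  assumes supp: "\<forall>x. x \<notin> cbox 0 M \<longrightarrow> p x = 0" and p: "continuous_on UNIV p"
    and one: "fourier (\<lambda>x. complex_of_real (p x)) 0 = 1"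
    and zero: "\<And>k. k \<in> integer_points \<Longrightarrow> k \<noteq> 0 \<Longrightarrow> fourier (\<lambda>x. complex_of_real (p x)) ((2 * pi) *\<^sub>R k) = 0"
  shows "periodization M p y = 1"
proof -
  let ?P = "periodization M p"
  have P: "continuous_on UNIV ?P"
    using supp p by (rule continuous_periodization)
  have PU: "?P y - 1 = 0" for y
  proof (rule torus_uniqueness)
    show "continuous_on UNIV (\<lambda>y. ?P y - 1)"
      by (intro continuous_intros P)
    show "?P (y + k) - 1 = ?P y - 1" if "k \<in> integer_points" for k y
      using that by (simp add: periodization_translate)
    fix k :: "real ^ 'n" assume k: "k \<in> integer_points"
    have "compact (?P ` cbox 0 1)"
      using P by (intro compact_continuous_image) (auto intro: continuous_on_subset)
    then obtain B where B: "\<And>y. y \<in> cbox 0 1 \<Longrightarrow> \<bar>?P y\<bar> \<le> B"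
      using compact_imp_bounded[of "?P ` cbox 0 1"] unfolding bounded_iff by auto
    have [measurable]: "?P \<in> borel_measurable borel"
      using P by (rule borel_measurable_continuous_onI)
    have i1: "integrable lborel (\<lambda>y. indicator unit_cube y *\<^sub>R (complex_of_real (?P y) * torus_char
        k y))"
      using B unit_cube_subset by (intro integrable_unit_cube[where B = B]) (auto simp: norm_mult)
    have i2: "integrable lborel (\<lambda>y. indicator unit_cube y *\<^sub>R torus_char k y)"
      by (intro integrable_unit_cube[where B = 1]) auto
    have "indicator unit_cube y *\<^sub>R (complex_of_real (?P y - 1) * torus_char k y)
      = indicator unit_cube y *\<^sub>R (complex_of_real (?P y) * torus_char k y)
          - indicator unit_cube y *\<^sub>R torus_char k y" for y
      by (simp add: algebra_simps)
    then have "(LINT y|lborel. indicator unit_cube y *\<^sub>R (complex_of_real (?P y - 1) * torus_char k y))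
      = (LINT x|lborel. complex_of_real (p x) * torus_char k x) - (if k = 0 then 1 else 0)"
      by (simp only: Bochner_Integration.integral_diff[OF i1 i2] periodization_fourier_coeff[OF supp p k]
          integral_unit_cube_torus_char[OF k])
    \<comment> \<open>The kernel of \<open>fourier\<close> has the opposite sign, hence
      \<open>- k\<close>; the lattice is symmetric.\<close>
    also have "(LINT x|lborel. complex_of_real (p x) * torus_char k x)
        = fourier (\<lambda>x. complex_of_real (p x)) ((2 * pi) *\<^sub>R - k)"
      by (simp add: fourier_def torus_char_def cis_conv_exp inner_commute mult_ac)
    also have "\<dots> = (if k = 0 then 1 else 0)"
      using zero[of "- k"] one k integer_points_closed(3)[OF k] by auto
    finally show "(LINT y|lborel. indicator unit_cube y *\<^sub>R (complex_of_real (?P y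
        - 1) * torus_char k y)) = 0"
      by simp
  qed
  show ?thesis
    using PU[of y] by simp
qed

section \<open>Zeros of the transform of a refinable function\<close>

lemma continuous_fourier:
  fixes f :: "real ^ 'n \<Rightarrow> complex"
  assumes f: "integrable lborel f"
  shows "isCont (fourier f) \<xi>"
  unfolding continuous_at_sequentially comp_def
proof (intro allI impI)
  fix u assume u: "u \<longlonglongrightarrow> \<xi>"
  have [measurable]: "f \<in> borel_measurable borel"
    using borel_measurable_integrable[OF f] by simp
  show "(\<lambda>n. fourier f (u n)) \<longlonglongrightarrow> fourier f \<xi>"
    unfolding fourier_def
  proof (rule integral_dominated_convergence[where w = "\<lambda>x. cmod (f x)"])
    show "AE x in lborel. (\<lambda>n. f x * exp (- \<i> * complex_of_real (x \<bullet> u n)))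
        \<longlonglongrightarrow> f x * exp (- \<i> * complex_of_real (x \<bullet> \<xi>))"
      by (intro AE_I2 tendsto_intros u)
  qed (use f in \<open>auto simp: norm_mult\<close>)
qed

lemma norm_ge_1_integer_points:
  assumes "k \<in> integer_points" "k \<noteq> 0"
  shows "1 \<le> norm k"
proof -
  obtain l where "k $ l \<noteq> 0"
    using assms(2) by (auto simp: vec_eq_iff)
  then have "1 \<le> \<bar>k $ l\<bar>"
    using assms(1) by (intro Ints_nonzero_abs_ge1) (auto simp: integer_points_def)
  then show ?thesis
    using component_le_norm_cart[of k l] by linarith
qed

text \<open>The sum rules do not constrain the mask at the points \<open>\<pi> k\<close> themselves, whence the limit
  argument for \<open>k\<close> with an odd component. The other \<open>k\<close> are halved until they have one.\<close>

lemma refinable_fourier_eq_0: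
  fixes \<phi> :: "real ^ 'n \<Rightarrow> complex"
  assumes \<phi>: "integrable lborel \<phi>" and ref: "refinable \<phi> a" and sr: "has_sum_rules a (Suc m)"
    and k: "k \<in> integer_points" "k \<noteq> 0"
  shows "fourier \<phi> ((2 * pi) *\<^sub>R k) = 0"
proof -
  have mask: "fourier \<phi> (2 *\<^sub>R \<xi>) = a \<xi> * fourier \<phi> \<xi>" for \<xi>
    using ref by (simp add: refinable_def)
  \<comment> \<open>The exponent measures the induction: halving \<open>k\<close> lowers it by one,
    and at 0 no nonzero integer point is left.\<close>
  obtain n :: nat where "norm k < 2 ^ n"
    using real_arch_pow[of 2 "norm k"] by auto
  then show ?thesis
    using k
  proof (induction n arbitrary: k)
    case 0
    then show ?case
      using norm_ge_1_integer_points[of k] by simp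
  next
    case (Suc n)
    define \<gamma> where "\<gamma> = (1 / 2) *\<^sub>R k"
    have k_eq: "(2 * pi) *\<^sub>R k = 2 *\<^sub>R ((2 * pi) *\<^sub>R \<gamma>)"
      by (simp add: \<gamma>_def)
    show ?case
    proof (cases "\<gamma> \<in> integer_points")
      case True
      have "norm \<gamma> < 2 ^ n" "\<gamma> \<noteq> 0"
        using Suc.prems by (simp_all add: \<gamma>_def)
      with True Suc.IH[of \<gamma>] show ?thesis
        unfolding k_eq mask by simp
    next
      case False
      have "2 *\<^sub>R \<gamma> \<in> integer_points"
        using Suc.prems by (simp add: \<gamma>_def)
      with False sr have "(\<lambda>\<xi>. a (\<xi> + (2 * pi) *\<^sub>R \<gamma>)) \<in> O[at 0](\<lambda>\<xi>. complex_of_real (norm \<xi> ^ Suc m))"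
        unfolding has_sum_rules_def by blast
      then obtain c where c: "\<forall>\<^sub>F \<xi> in at 0. cmod (a (\<xi> + (2 * pi) *\<^sub>R \<gamma>))
          \<le> c * cmod (complex_of_real (norm \<xi> ^ Suc m))"
        by (elim landau_o.bigE)
      have "((\<lambda>\<xi>. a (\<xi> + (2 * pi) *\<^sub>R \<gamma>)) \<longlongrightarrow> 0) (at 0)"
      proof (rule Lim_null_comparison[OF c])
        have "((\<lambda>\<xi>::real^'n. c * cmod (complex_of_real (norm \<xi> ^ Suc m))) \<longlongrightarrow> c * cmod
            (complex_of_real (norm (0::real^'n) ^ Suc m))) (at 0)"
          by (intro tendsto_intros)
        then show "((\<lambda>\<xi>::real^'n. c * cmod (complex_of_real (norm \<xi> ^ Suc m))) \<longlongrightarrow> 0) (at 0)"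
          by simp
      qed
      \<comment> \<open>Both sides of the refinement equation are needed, \<open>b = 1\<close> for
        the factor beside the mask and \<open>b = 2\<close> for the left side.\<close>
      moreover have lin: "isCont (\<lambda>\<xi>. fourier \<phi> (b *\<^sub>R (\<xi> + (2 * pi) *\<^sub>R \<gamma>))) 0" for b
        by (intro isCont_o2[OF _ continuous_fourier[OF \<phi>]] continuous_intros)
      then have "((\<lambda>\<xi>. fourier \<phi> (1 *\<^sub>R (\<xi> + (2 * pi) *\<^sub>R \<gamma>))) \<longlongrightarrow> fourier \<phi> (1 *\<^sub>R (0
          + (2 * pi) *\<^sub>R \<gamma>))) (at 0)"
        unfolding isCont_def .
      ultimately have "((\<lambda>\<xi>. a (\<xi> + (2 * pi) *\<^sub>R \<gamma>) * fourier \<phi> (1 *\<^sub>R (\<xi>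
          + (2 * pi) *\<^sub>R \<gamma>))) \<longlongrightarrow> 0 * fourier \<phi> (1 *\<^sub>R (0 + (2 * pi) *\<^sub>R \<gamma>))) (at 0)"
        by (rule tendsto_mult)
      then have "((\<lambda>\<xi>. fourier \<phi> (2 *\<^sub>R (\<xi> + (2 * pi) *\<^sub>R \<gamma>))) \<longlongrightarrow> 0) (at 0)"
        by (simp only: mask scaleR_one mult_zero_left)
      moreover have "((\<lambda>\<xi>. fourier \<phi> (2 *\<^sub>R (\<xi> + (2 * pi) *\<^sub>R \<gamma>))) \<longlongrightarrow> fourier \<phi> (2 *\<^sub>R (0
          + (2 * pi) *\<^sub>R \<gamma>))) (at 0)"
        using lin[of 2] unfolding isCont_def .
      ultimately have "fourier \<phi> (2 *\<^sub>R (0 + (2 * pi) *\<^sub>R \<gamma>)) = 0"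
        by (intro tendsto_unique[where F = "at (0::real^'n)"]) auto
      then show ?thesis
        unfolding k_eq by simp
    qed
  qed
qed

subsection \<open>Reconstruction from intensities\<close>

lemma cmod_squared_diff_le:
  "\<bar>(cmod z)\<^sup>2 - (cmod w)\<^sup>2\<bar> \<le> cmod (z - w) * (cmod z + cmod w)"
proof -
  have "(cmod z)\<^sup>2 - (cmod w)\<^sup>2 = (cmod z - cmod w) * (cmod z + cmod w)"
    by (simp add: power2_eq_square algebra_simps)
  then show ?thesis
    using norm_triangle_ineq3[of z w] by (simp add: abs_mult mult_right_mono)
qed

text \<open>The reconstruction inverts the linear system satisfied by \<open>f x\<close> up to the terms in which
  \<open>f\<close> is evaluated at \<open>x'\<close> and \<open>x''\<close> instead of \<open>x\<close>.\<close>

lemma reconstructed_sample_error: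
  assumes adm: "admissibility_quotient g x x' x'' \<le> ereal \<gamma>"
    and B: "cmod (f x) \<le> B" "cmod (f x') \<le> B" "cmod (f x'') \<le> B"
    and G: "cmod (g x') \<le> G" "cmod (g x'') \<le> G"
  shows "cmod (reconstructed_sample (intensity f g) g x x' x'' - f x)
    \<le> \<gamma> * (2 * B + 2 * G) * (cmod (f x - f x') + cmod (f x - f x''))"
proof -
  define c \<delta> h e where "c = Re (g x - g x')" and "\<delta> = Im (g x - g x')"
    and "h = Re (g x - g x'')" and "e = Im (g x - g x'')"
  define \<mu> where "\<mu> = c * e - \<delta> * h"
  define num where "num = max (cmod (g x - g x')) (cmod (g x - g x''))"
  have den: "\<bar>Im ((g x - g x') * (cnj (g x) - cnj (g x'')))\<bar> = \<bar>\<mu>\<bar>"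
    by (simp add: \<mu>_def c_def \<delta>_def h_def e_def algebra_simps abs_minus_commute)
  have num: "max (cmod (g x - g x')) (cmod (cnj (g x) - cnj (g x''))) = num"
    unfolding num_def complex_cnj_diff[symmetric] complex_mod_cnj ..
  have "\<mu> \<noteq> 0" and q: "num / \<bar>\<mu>\<bar> \<le> \<gamma>"
    using adm unfolding admissibility_quotient_def Let_def den num by (auto split: if_splits)
  \<comment> \<open>Expanding the squares in the data leaves
    \<open>2 * Re (f x * cnj (g x - g y))\<close>, which is linear in the unknown
    \<open>f x\<close>; \<open>err y\<close> is everything else. It vanishes when
    \<open>f y = f x\<close>.\<close>
  define err where "err y = (cmod (f x))\<^sup>2 - (cmod (f y))\<^sup>2 + 2 * Re ((f x - f y) * cnj (g y))" for y
  have err: "\<bar>err y\<bar> \<le> (2 * B + 2 * G) * cmod (f x - f y)" if "cmod (f y) \<le> B" "cmod (g y) \<le> G" for y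
  proof -
    have "\<bar>(cmod (f x))\<^sup>2 - (cmod (f y))\<^sup>2\<bar> \<le> cmod (f x - f y) * (2 * B)"
      using that B(1) by (intro order_trans[OF cmod_squared_diff_le] mult_left_mono) auto
    moreover have "\<bar>Re ((f x - f y) * cnj (g y))\<bar> \<le> cmod (f x - f y) * G"
      using that by (intro order_trans[OF abs_Re_le_cmod]) (simp add: norm_mult mult_left_mono)
    ultimately have "\<bar>err y\<bar> \<le> cmod (f x - f y) * (2 * B) + 2 * (cmod (f x - f y) * G)"
      unfolding err_def by linarith
    then show ?thesis
      by (simp add: algebra_simps)
  qed
  have data: "intensity f g x - intensity f g y + (cmod (g y))\<^sup>2 - (cmod (g x))\<^sup>2
      = 2 * (Re (f x) * Re (g x - g y) + Im (f x) * Im (g x - g y)) + err y" for y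
    unfolding intensity_def err_def cmod_power2 by (simp add: power2_eq_square algebra_simps)
  have Re: "1 / (2 * \<mu>) * (e * (2 * (Re (f x) * c + Im (f x) * \<delta>) + E1) - \<delta> * (2 * (Re (f x) * h
      + Im (f x) * e) + E2)) - Re (f x)
      = (e * E1 - \<delta> * E2) / (2 * \<mu>)" for E1 E2
  proof -
    have "e * (2 * (Re (f x) * c + Im (f x) * \<delta>) + E1) - \<delta> * (2 * (Re (f x) * h + Im (f x) * e) + E2)
      = Re (f x) * (2 * \<mu>) + (e * E1 - \<delta> * E2)"
      by (simp add: \<mu>_def algebra_simps)
    then show ?thesis
      using \<open>\<mu> \<noteq> 0\<close> by (simp add: add_divide_distrib)
  qed
  have Im: "1 / (2 * \<mu>) * (- h * (2 * (Re (f x) * c + Im (f x) * \<delta>) + E1) + c * (2 * (Re (f x) * h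
      + Im (f x) * e) + E2)) - Im (f x)
      = (c * E2 - h * E1) / (2 * \<mu>)" for E1 E2
  proof -
    have "- h * (2 * (Re (f x) * c + Im (f x) * \<delta>) + E1) + c * (2 * (Re (f x) * h + Im (f x) * e) + E2)
      = Im (f x) * (2 * \<mu>) + (c * E2 - h * E1)"
      by (simp add: \<mu>_def algebra_simps)
    then show ?thesis
      using \<open>\<mu> \<noteq> 0\<close> by (simp only:) (simp add: add_divide_distrib)
  qed
  let ?r = "reconstructed_sample (intensity f g) g x x' x'' - f x"
  have rs: "reconstructed_sample (intensity f g) g x x' x'' = Complex
      (1 / (2 * \<mu>) * (e * (2 * (Re (f x) * c + Im (f x) * \<delta>) + err x') - \<delta> * (2 * (Re (f x) * h
          + Im (f x) * e) + err x'')))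
      (1 / (2 * \<mu>) * (- h * (2 * (Re (f x) * c + Im (f x) * \<delta>) + err x') + c * (2 * (Re (f x) * h
          + Im (f x) * e) + err x'')))"
    unfolding reconstructed_sample_def Let_def data \<mu>_def c_def \<delta>_def h_def e_def by (rule refl)
  have "Re ?r = (e * err x' - \<delta> * err x'') / (2 * \<mu>)"
    unfolding rs minus_complex.sel complex.sel by (rule Re)
  moreover have "Im ?r = (c * err x'' - h * err x') / (2 * \<mu>)"
    unfolding rs minus_complex.sel complex.sel by (rule Im)
  ultimately have "cmod ?r \<le> \<bar>(e * err x' - \<delta> * err x'') / (2 * \<mu>)\<bar> + \<bar>(c * err x''
      - h * err x') / (2 * \<mu>)\<bar>"
    using cmod_le[of ?r] by simp
  also have "\<dots> = (\<bar>e * err x' - \<delta> * err x''\<bar> + \<bar>c * err x'' - h * err x'\<bar>) / (2 * \<bar>\<mu>\<bar>)"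
    by (simp add: abs_mult add_divide_distrib)
  \<comment> \<open>All four matrix entries are at most \<open>num\<close>. The factor 2 from the
    two rows cancels that of the denominator and leaves exactly the admissibility quotient.\<close>
  also have "\<dots> \<le> (2 * (num * (\<bar>err x'\<bar> + \<bar>err x''\<bar>))) / (2 * \<bar>\<mu>\<bar>)"
  proof (rule divide_right_mono)
    have "\<bar>c\<bar> \<le> num" "\<bar>\<delta>\<bar> \<le> num" "\<bar>h\<bar> \<le> num" "\<bar>e\<bar> \<le> num"
      using abs_Re_le_cmod[of "g x - g x'"] abs_Im_le_cmod[of "g x - g x'"]
        abs_Re_le_cmod[of "g x - g x''"] abs_Im_le_cmod[of "g x - g x''"]
      unfolding c_def \<delta>_def h_def e_def num_def by linarith+
    then have "\<bar>e * err x'\<bar> \<le> num * \<bar>err x'\<bar>" "\<bar>\<delta> * err x''\<bar> \<le> num * \<bar>err x''\<bar>"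
      "\<bar>c * err x''\<bar> \<le> num * \<bar>err x''\<bar>" "\<bar>h * err x'\<bar> \<le> num * \<bar>err x'\<bar>"
      by (simp_all add: abs_mult mult_right_mono)
    then show "\<bar>e * err x' - \<delta> * err x''\<bar> + \<bar>c * err x'' - h * err x'\<bar> \<le> 2 * (num * (\<bar>err x'\<bar>
        + \<bar>err x''\<bar>))"
      unfolding distrib_left by linarith
  qed simp
  also have "\<dots> = num / \<bar>\<mu>\<bar> * (\<bar>err x'\<bar> + \<bar>err x''\<bar>)"
    by simp
  also have "\<dots> \<le> \<gamma> * ((2 * B + 2 * G) * cmod (f x - f x') + (2 * B + 2 * G) * cmod (f x - f x''))"
  proof (rule mult_mono[OF q])
    have "0 \<le> num / \<bar>\<mu>\<bar>"
      by (simp add: num_def le_max_iff_disj)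
    with q show "0 \<le> \<gamma>"
      by linarith
  qed (use err[OF B(2) G(1)] err[OF B(3) G(2)] in auto)
  finally show ?thesis
    by (simp add: algebra_simps)
qed

text \<open>If the integrand is not integrable on \<Omega>, its integral has the default value 0 and
  the bound is trivial, so \<open>h\<close> may be arbitrary apart from the bound.\<close>

lemma L2_norm_on_le:
  assumes \<Omega>: "bounded \<Omega>" "\<Omega> \<in> sets lebesgue" and "0 \<le> D"
    and ae: "AE x in lebesgue. x \<in> \<Omega> \<longrightarrow> cmod (h x) \<le> D"
  shows "L2_norm_on \<Omega> h \<le> D * sqrt (measure lebesgue \<Omega>)"
proof -
  have fin: "\<Omega> \<in> lmeasurable"
    using \<Omega> by (rule bounded_set_imp_lmeasurable)
  have iD: "integrable lebesgue (\<lambda>x. D\<^sup>2 * indicator \<Omega> x)"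
    using fin by (intro integrable_mult_right integrable_real_indicator) (auto simp: fmeasurable_def)
  have "(LINT x:\<Omega>|lebesgue. (cmod (h x))\<^sup>2) \<le> (LINT x|lebesgue. D\<^sup>2 * indicator \<Omega> x)"
  proof (cases "integrable lebesgue (\<lambda>x. indicator \<Omega> x *\<^sub>R (cmod (h x))\<^sup>2)")
    case True
    show ?thesis
      unfolding set_lebesgue_integral_def
    proof (rule integral_mono_AE[OF True iD])
      show "AE x in lebesgue. indicator \<Omega> x *\<^sub>R (cmod (h x))\<^sup>2 \<le> D\<^sup>2 * indicator \<Omega> x"
        using ae by eventually_elim (auto simp: indicator_def intro: power_mono)
    qed
  next
    case False
    then show ?thesis
      by (simp add: set_lebesgue_integral_def not_integrable_integral_eq)
  qed
  also have "\<dots> = D\<^sup>2 * measure lebesgue \<Omega>"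
    by simp
  finally have "L2_norm_on \<Omega> h \<le> sqrt (D\<^sup>2 * measure lebesgue \<Omega>)"
    unfolding L2_norm_on_def by (rule real_sqrt_le_mono)
  then show ?thesis
    using \<open>0 \<le> D\<close> by (simp add: real_sqrt_mult)
qed

section \<open>Constants uniform in the level, and the geometry of the index sets\<close>

lemma uniformly_admissibleE:
  assumes "uniformly_admissible \<Xi> g"
  obtains \<gamma> G where "\<gamma> > 0"
    and "\<And>N k k' k''. N \<ge> 1 \<Longrightarrow> (k, k', k'') \<in> \<Xi> N \<Longrightarrow>
      admissibility_quotient (g N) (grid N k) (grid N k') (grid N k'') \<le> ereal \<gamma> \<and>
      cmod (g N (grid N k')) \<le> G \<and> cmod (g N (grid N k'')) \<le> G"
proof -
  obtain \<gamma> where \<gamma>: "\<gamma> > 0" "\<And>N. N \<ge> 1 \<Longrightarrow> admissible \<gamma> (\<Xi> N) N (g N)"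
    using assms unfolding uniformly_admissible_def by blast
  let ?m = "\<lambda>N (k, k', k''). ereal (Max {cmod (g N (grid N k)), cmod (g N (grid N k')), cmod (g N
      (grid N k''))})"
  have "(SUP N\<in>{1..}. SUP t\<in>\<Xi> N. ?m N t) \<noteq> \<infinity>"
    using assms unfolding uniformly_admissible_def by auto
  then obtain n where n: "(SUP N\<in>{1..}. SUP t\<in>\<Xi> N. ?m N t) < ereal (real n)"
    using less_PInf_Ex_of_nat by blast
  show ?thesis
  proof (rule that[OF \<gamma>(1)])
    fix N :: nat and k k' k''
    assume N: "N \<ge> 1" and k: "(k, k', k'') \<in> \<Xi> N"
    let ?q = "\<lambda>(k, k', k''). admissibility_quotient (g N) (grid N k) (grid N k') (grid N k'')"
    have "(SUP t\<in>\<Xi> N. ?q t) \<le> ereal \<gamma>"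
      using \<gamma>(2)[OF N] unfolding admissible_def by (rule conjunct2)
    then have "?q (k, k', k'') \<le> ereal \<gamma>"
      by (rule order_trans[OF SUP_upper[OF k]])
    moreover have "?m N (k, k', k'') \<le> ereal (real n)"
    proof -
      have "?m N (k, k', k'') \<le> (SUP t\<in>\<Xi> N. ?m N t)"
        by (rule SUP_upper[OF k])
      also have "\<dots> \<le> (SUP N\<in>{1..}. SUP t\<in>\<Xi> N. ?m N t)"
        using N by (intro SUP_upper) auto
      also note less_imp_le[OF n]
      finally show ?thesis .
    qed
    ultimately show "admissibility_quotient (g N) (grid N k) (grid N k') (grid N k'') \<le> ereal \<gamma> \<and>
      cmod (g N (grid N k')) \<le> real n \<and> cmod (g N (grid N k'')) \<le> real n"
      by simp
  qed
qed

text \<open>The box does not depend on \<open>N\<close>. It bounds the spherical offsets, which are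
  proportional to \<open>grid N k\<close>. The absolute value makes it valid for either sign of
  \<open>M $ l\<close>.\<close>

lemma grid_in_cbox:
  assumes "k \<in> Lambda \<Omega> M N"
  shows "grid N k \<in> cbox (L_min \<Omega> - (\<chi> l. \<bar>M $ l\<bar>)) (L_max \<Omega>)"
proof -
  have "L_min \<Omega> $ l - \<bar>M $ l\<bar> \<le> (1 / 2 ^ N) * k $ l \<and> (1 / 2 ^ N) * k $ l \<le> L_max \<Omega> $ l" for l
  proof -
    have k: "2 ^ N * L_min \<Omega> $ l - M $ l \<le> k $ l" "k $ l \<le> 2 ^ N * L_max \<Omega> $ l"
      using assms by (auto simp: Lambda_def)
    have "\<bar>M $ l\<bar> \<le> 2 ^ N * \<bar>M $ l\<bar>"
      by (simp add: mult_le_cancel_right1)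
    with k have "2 ^ N * (L_min \<Omega> $ l - \<bar>M $ l\<bar>) \<le> k $ l"
      by (simp add: right_diff_distrib)
    with k show ?thesis
      by (simp add: field_simps)
  qed
  then show ?thesis
    by (simp add: grid_def mem_box_cart)
qed

lemma finite_Lambda: "finite (Lambda \<Omega> M N)"
proof (rule finite_subset)
  show "Lambda \<Omega> M N \<subseteq> integer_points \<inter> cbox (2 ^ N *\<^sub>R L_min \<Omega> - M) (2 ^ N *\<^sub>R L_max \<Omega>)"
    by (auto simp: Lambda_def mem_box_cart)
qed (rule finite_integer_points_cbox)

text \<open>Treats both geometries at once. The constant \<rho> is 1 for plane waves, the length of
  the axis vector; in the spherical case the offset is \<open>grid N k\<close> divided by
  \<open>2 ^ N\<close>, up to sign, so \<rho> bounds the norms of the grid points.\<close>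

lemma index_triples:
  assumes "(\<Xi> = Xi_pl \<Omega> M j\<^sub>0) \<or> (\<Xi> = Xi_sph \<Omega> M)"
  obtains k\<^sub>1 k\<^sub>2 \<rho> where "0 < \<rho>"
    and "\<And>N. \<Xi> N = (\<lambda>k. (k, k\<^sub>1 N k, k\<^sub>2 N k)) ` Lambda \<Omega> M N"
    and "\<And>N k. k \<in> Lambda \<Omega> M N \<Longrightarrow>
      norm (grid N k - grid N (k\<^sub>1 N k)) \<le> \<rho> / 2 ^ N \<and> norm (grid N k - grid N (k\<^sub>2 N k)) \<le> \<rho> / 2 ^ N"
  using assms
proof
  assume \<Xi>: "\<Xi> = Xi_pl \<Omega> M j\<^sub>0"
  show ?thesis
  proof (rule that[of 1 "\<lambda>N k. k + axis j\<^sub>0 1" "\<lambda>N k. k - axis j\<^sub>0 1"])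
    show "norm (grid N k - grid N (k + axis j\<^sub>0 1)) \<le> 1 / 2 ^ N \<and> norm (grid N k - grid N (k
        - axis j\<^sub>0 1)) \<le> 1 / 2 ^ N" for N k
      by (simp add: grid_def scaleR_add_right scaleR_diff_right norm_axis_1)
  qed (simp_all add: \<Xi> Xi_pl_def)
next
  assume \<Xi>: "\<Xi> = Xi_sph \<Omega> M"
  obtain \<rho> where \<rho>: "0 < \<rho>" "\<And>x. x \<in> cbox (L_min \<Omega> - (\<chi> l. \<bar>M $ l\<bar>)) (L_max \<Omega>) \<Longrightarrow> norm x \<le> \<rho>"
    using bounded_cbox[of "L_min \<Omega> - (\<chi> l. \<bar>M $ l\<bar>)" "L_max \<Omega>"] unfolding bounded_pos by blast
  show ?thesis
  proof (rule that[of \<rho> "\<lambda>N k. (1 + 1 / 2 ^ N) *\<^sub>R k" "\<lambda>N k. (1 - 1 / 2 ^ N) *\<^sub>R k"])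
    fix N k assume "k \<in> Lambda \<Omega> M N"
    then have le: "norm (grid N k) \<le> \<rho>"
      by (intro \<rho>(2) grid_in_cbox)
    have eq: "grid N k - grid N ((1 + 1 / 2 ^ N) *\<^sub>R k) = - (1 / 2 ^ N) *\<^sub>R grid N k"
      "grid N k - grid N ((1 - 1 / 2 ^ N) *\<^sub>R k) = (1 / 2 ^ N) *\<^sub>R grid N k"
      by (simp_all add: grid_def algebra_simps)
    show "norm (grid N k - grid N ((1 + 1 / 2 ^ N) *\<^sub>R k)) \<le> \<rho> / 2 ^ N \<and>
        norm (grid N k - grid N ((1 - 1 / 2 ^ N) *\<^sub>R k)) \<le> \<rho> / 2 ^ N"
      unfolding eq using le by (simp add: divide_right_mono)
  qed (simp_all add: \<Xi> Xi_sph_def \<rho>)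
qed

section \<open>The uniform pointwise estimate and the resulting rate\<close>

theorem theorem1p1:
  fixes \<Omega> :: "(real ^ 'n) set" and M :: "real ^ 'n" and j\<^sub>0 :: 'n
    and \<Xi> :: "nat \<Rightarrow> 'n triple set" and g :: "nat \<Rightarrow> real ^ 'n \<Rightarrow> complex"
    and \<phi> a f :: "real ^ 'n \<Rightarrow> complex" and s \<sigma> :: real
  assumes "bounded \<Omega>" and "\<Omega> \<in> sets lebesgue" and "\<Omega> \<inter> integer_points \<noteq> {}"
    and "negligible (\<Omega> - cbox (L_min \<Omega>) (L_max \<Omega>))"
    and "\<forall>l. M $ l > 0"
    and "(\<Xi> = Xi_pl \<Omega> M j\<^sub>0 \<and> (\<forall>N\<ge>1. plane_wave (g N))) \<or>
         (\<Xi> = Xi_sph \<Omega> M \<and> (\<forall>N\<ge>1. spherical_wave (g N)) \<and> (\<forall>N\<ge>1. 0 \<notin> Lambda \<Omega> M N))"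
    and "uniformly_admissible \<Xi> g"
    and "s > real CARD('n) / 2"
    and "\<phi> \<in> sobolev s" and "continuous_on UNIV \<phi>"
    and "\<forall>x. \<phi> x \<in> \<real>\<^sub>\<ge>\<^sub>0"
    and "closure {x. \<phi> x \<noteq> 0} \<subseteq> cbox 0 M"
    and "refinable \<phi> a"
    and "sobolev_exponent \<phi> > ereal \<sigma>" and "\<sigma> > s"
    and "sum_rule_order a > ereal \<sigma>"
    and "f \<in> sobolev \<sigma>" and "continuous_on UNIV f"
  shows "(\<lambda>N. L2_norm_on \<Omega>
            (\<lambda>x. f x - approximant (\<Xi> N) \<phi> N (intensity f (g N)) (g N) x))
         \<in> O(\<lambda>N. 2 powr (- real N * min 1 (\<sigma> - s) / 2))"
proof -
  define \<alpha> where "\<alpha> = min 1 (\<sigma> - s)"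
  have \<alpha>: "0 < \<alpha>" "\<alpha> \<le> 1" "CARD('n) / 2 < \<sigma> - \<alpha>"
    using assms(8,15) by (auto simp: \<alpha>_def min_def)
  obtain B C0 where B: "\<And>x. cmod (f x) \<le> B" and C0: "\<And>x y. cmod (f x - f y) \<le> C0 * norm (x - y) powr \<alpha>"
    using sobolev_bounded_hoelder[OF assms(17,18) \<alpha>] by blast
  define C where "C = max C0 0"
  have "C \<ge> 0"
    by (simp add: C_def)
  have C: "cmod (f x - f y) \<le> C * norm (x - y) powr \<alpha>" for x y
    using C0[of x y] mult_right_mono[of C0 C "norm (x - y) powr \<alpha>"] by (simp add: C_def)
  have C_scaled: "cmod (f x - f y) \<le> C * r powr \<alpha> * 2 powr (- real N * \<alpha>)"
    if "norm (x - y) \<le> r / 2 ^ N" "0 \<le> r" for x y r N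
  proof -
    have "norm (x - y) powr \<alpha> \<le> (r * 2 powr (- real N)) powr \<alpha>"
      using that \<alpha> by (intro powr_mono2) (auto simp: powr_minus powr_realpow field_simps)
    also have "\<dots> = r powr \<alpha> * 2 powr (- real N * \<alpha>)"
      using that by (simp add: powr_mult powr_powr)
    finally show ?thesis
      using \<open>C \<ge> 0\<close> C[of x y] mult_left_mono[of "norm (x
          - y) powr \<alpha>" "r powr \<alpha> * 2 powr (- real N * \<alpha>)" C]
      by (simp add: mult.assoc)
  qed
  obtain \<gamma> G where \<gamma>: "\<gamma> > 0" and adm: "\<And>N k k' k''. N \<ge> 1 \<Longrightarrow> (k, k', k'') \<in> \<Xi> N \<Longrightarrow>
      admissibility_quotient (g N) (grid N k) (grid N k') (grid N k'') \<le> ereal \<gamma> \<and>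
      cmod (g N (grid N k')) \<le> G \<and> cmod (g N (grid N k'')) \<le> G"
    using uniformly_admissibleE[OF assms(7)] by blast
  have disj: "\<Xi> = Xi_pl \<Omega> M j\<^sub>0 \<or> \<Xi> = Xi_sph \<Omega> M"
    using assms(6) by blast
  obtain k\<^sub>1 k\<^sub>2 \<rho> where \<rho>: "0 < \<rho>"
    and \<Xi>: "\<And>N. \<Xi> N = (\<lambda>k. (k, k\<^sub>1 N k, k\<^sub>2 N k)) ` Lambda \<Omega> M N"
    and near: "\<And>N k. k \<in> Lambda \<Omega> M N \<Longrightarrow>
      norm (grid N k - grid N (k\<^sub>1 N k)) \<le> \<rho> / 2 ^ N \<and> norm (grid N k - grid N (k\<^sub>2 N k)) \<le> \<rho> / 2 ^ N"
    by (rule index_triples[OF disj], rule that)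
  define p where "p x = Re (\<phi> x)" for x
  have \<phi>p: "\<phi> x = complex_of_real (p x)" and p0: "p x \<ge> 0" for x
    using assms(11) by (auto simp: p_def nonneg_Reals_def complex_eq_iff)
  have \<phi>_supp: "\<forall>x. x \<notin> cbox 0 M \<longrightarrow> \<phi> x = 0"
    using assms(12) closure_subset[of "{x. \<phi> x \<noteq> 0}"] by auto
  then have p_supp: "\<forall>x. x \<notin> cbox 0 M \<longrightarrow> p x = 0"
    by (simp add: p_def)
  have p_cont: "continuous_on UNIV p"
    unfolding p_def[abs_def] by (intro continuous_intros assms(10))
  have \<phi>_int: "integrable lborel \<phi>"
    by (rule continuous_compact_support_integrable[OF \<phi>_supp assms(10)])
  \<comment> \<open>A supremum above \<sigma> is taken over a nonempty set, which yields a positive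
    number of sum rules.\<close>
  obtain \<kappa> where sr: "has_sum_rules a (Suc \<kappa>)"
    using assms(16) unfolding sum_rule_order_def less_Sup_iff by auto
  have unity: "periodization M p y = 1" for y
  proof (rule periodization_eq_1[OF p_supp p_cont])
    show "fourier (\<lambda>x. complex_of_real (p x)) 0 = 1"
      using assms(13) unfolding refinable_def \<phi>p[symmetric] by simp
    show "fourier (\<lambda>x. complex_of_real (p x)) ((2 * pi) *\<^sub>R k) = 0" if "k \<in> integer_points" "k \<noteq> 0" for k
      unfolding \<phi>p[symmetric] by (rule refinable_fourier_eq_0[OF \<phi>_int assms(13) sr that])
  qed
  \<comment> \<open>The first summand pays for moving from \<open>x\<close> to a grid point, at most
    \<open>norm M / 2 ^ N\<close> away; the second is the sample error, with one Hoelder bound for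
    each of the two neighbours.\<close>
  define D where "D = C * norm M powr \<alpha> + \<gamma> * (2 * B + 2 * G) * (2 * (C * \<rho> powr \<alpha>))"
  have pointwise: "cmod (f x - approximant (\<Xi> N) \<phi> N (intensity f (g N)) (g N) x)
      \<le> D * 2 powr (- real N * \<alpha>)"
    if N: "N \<ge> 1" and x: "x \<in> cbox (L_min \<Omega>) (L_max \<Omega>)" for N x
  proof -
    define rec where "rec k = reconstructed_sample (intensity f (g N)) (g N) (grid N k) (grid N (k\<^sub>1
        N k)) (grid N (k\<^sub>2 N k))" for k
    have S: "approximant (\<Xi> N) \<phi> N (intensity f (g N)) (g N) x
        = (\<Sum>k\<in>Lambda \<Omega> M N. rec k * complex_of_real (p (2 ^ N *\<^sub>R x - k)))"
      unfolding approximant_def \<Xi> by (subst sum.reindex) (auto simp: inj_on_def rec_def \<phi>p)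
    \<comment> \<open>The lower bound of \<open>Lambda\<close> is extended by \<open>M\<close>
      precisely so that, for \<open>x\<close> in the box, no index with
      \<open>2 ^ N *\<^sub>R x - k\<close> in \<open>cbox 0 M\<close> is missing.\<close>
    have one: "(\<Sum>k\<in>Lambda \<Omega> M N. p (2 ^ N *\<^sub>R x - k)) = 1"
      unfolding unity[of "2 ^ N *\<^sub>R x", symmetric]
    proof (rule periodization_eq_sum[symmetric, OF p_supp finite_Lambda])
      show "Lambda \<Omega> M N \<subseteq> integer_points"
        by (auto simp: Lambda_def)
      fix k assume k: "k \<in> integer_points" "2 ^ N *\<^sub>R x - k \<in> cbox 0 M"
      have "2 ^ N * L_min \<Omega> $ l - M $ l \<le> k $ l \<and> k $ l \<le> 2 ^ N * L_max \<Omega> $ l" for l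
      proof -
        have "L_min \<Omega> $ l \<le> x $ l" "x $ l \<le> L_max \<Omega> $ l"
          using x by (simp_all add: mem_box_cart)
        then have "2 ^ N * L_min \<Omega> $ l \<le> 2 ^ N * x $ l" "2 ^ N * x $ l \<le> 2 ^ N * L_max \<Omega> $ l"
          by simp_all
        moreover have "0 \<le> 2 ^ N * x $ l - k $ l" "2 ^ N * x $ l - k $ l \<le> M $ l"
          using k(2) by (simp_all add: mem_box_cart)
        ultimately show ?thesis
          by linarith
      qed
      with k(1) show "k \<in> Lambda \<Omega> M N"
        by (simp add: Lambda_def)
    qed
    \<comment> \<open>Kept multiplied by the weight: only where it is nonzero is the grid point
      known to be close to \<open>x\<close>.\<close>
    have summand: "cmod (f x - rec k) * p (2 ^ N *\<^sub>R x - k)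
        \<le> D * 2 powr (- real N * \<alpha>) * p (2 ^ N *\<^sub>R x - k)"
      if k: "k \<in> Lambda \<Omega> M N" for k
    proof (cases "p (2 ^ N *\<^sub>R x - k) = 0")
      case False
      then have box: "2 ^ N *\<^sub>R x - k \<in> cbox 0 M"
        using p_supp by blast
      have "norm (2 ^ N *\<^sub>R x - k) \<le> norm M"
        using box by (intro norm_le_componentwise_cart) (auto simp: mem_box_cart intro: order_trans)
      moreover have "x - grid N k = (1 / 2 ^ N) *\<^sub>R (2 ^ N *\<^sub>R x - k)"
        by (simp add: grid_def scaleR_diff_right)
      ultimately have "norm (x - grid N k) \<le> norm M / 2 ^ N"
        by (simp add: divide_right_mono)
      then have 1: "cmod (f x - f (grid N k)) \<le> C * norm M powr \<alpha> * 2 powr (- real N * \<alpha>)"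
        by (rule C_scaled) simp
      have tri: "(k, k\<^sub>1 N k, k\<^sub>2 N k) \<in> \<Xi> N"
        using k by (auto simp: \<Xi>)
      have BG: "0 \<le> \<gamma> * (2 * B + 2 * G)"
      proof -
        have "0 \<le> B" "0 \<le> G"
          using order_trans[OF norm_ge_zero B] adm[OF N tri]
              by (auto intro: order_trans[OF norm_ge_zero])
        then show ?thesis
          using \<gamma> by simp
      qed
      have "cmod (rec k - f (grid N k)) \<le> \<gamma> * (2 * B + 2 * G) *
          (cmod (f (grid N k) - f (grid N (k\<^sub>1 N k))) + cmod (f (grid N k) - f (grid N (k\<^sub>2 N k))))"
        unfolding rec_def using adm[OF N tri] B by (intro reconstructed_sample_error) auto
      also have "\<dots> \<le> \<gamma> * (2 * B + 2 * G) *
          (C * \<rho> powr \<alpha> * 2 powr (- real N * \<alpha>) + C * \<rho> powr \<alpha> * 2 powr (- real N * \<alpha>))"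
        using near[OF k] \<rho> by (intro mult_left_mono[OF _ BG] add_mono C_scaled) auto
      finally have 2: "cmod (rec k - f (grid N k)) \<le> \<gamma> * (2 * B
          + 2 * G) * (2 * (C * \<rho> powr \<alpha>)) * 2 powr (- real N * \<alpha>)"
        by (simp add: algebra_simps)
      have "cmod (f x - rec k) \<le> cmod (f x - f (grid N k)) + cmod (rec k - f (grid N k))"
        by (metis norm_minus_commute norm_triangle_ineq4 diff_diff_eq2 diff_add_cancel add_diff_eq
            norm_triangle_le_diff order_refl)
      also have "\<dots> \<le> D * 2 powr (- real N * \<alpha>)"
        using 1 2 unfolding D_def distrib_right by linarith
      finally show ?thesis
        by (rule mult_right_mono) (rule p0)
    qed simp
    have "f x - approximant (\<Xi> N) \<phi> N (intensity f (g N)) (g N) x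
        = (\<Sum>k\<in>Lambda \<Omega> M N. (f x - rec k) * complex_of_real (p (2 ^ N *\<^sub>R x - k)))"
    proof -
      have "f x = f x * complex_of_real (\<Sum>k\<in>Lambda \<Omega> M N. p (2 ^ N *\<^sub>R x - k))"
        by (simp add: one)
      also have "\<dots> = (\<Sum>k\<in>Lambda \<Omega> M N. f x * complex_of_real (p (2 ^ N *\<^sub>R x - k)))"
        by (simp add: sum_distrib_left)
      finally show ?thesis
        unfolding S by (simp add: left_diff_distrib sum_subtractf)
    qed
    also have "cmod \<dots> \<le> (\<Sum>k\<in>Lambda \<Omega> M N. cmod (f x - rec k) * p (2 ^ N *\<^sub>R x - k))"
      by (rule order_trans[OF norm_sum]) (simp add: norm_mult p0)
    also have "\<dots> \<le> (\<Sum>k\<in>Lambda \<Omega> M N. D * 2 powr (- real N * \<alpha>) * p (2 ^ N *\<^sub>R x - k))"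
      by (intro sum_mono summand)
    also have "\<dots> = D * 2 powr (- real N * \<alpha>)"
      by (simp only: sum_distrib_left[symmetric] one mult_1_right)
    finally show ?thesis .
  qed
  \<comment> \<open>The sign of \<open>G\<close>, and with it that of \<open>D\<close>, is known
    only once some triple exists; truncation avoids the distinction.\<close>
  define D' where "D' = max D 0"
  have "L2_norm_on \<Omega> (\<lambda>x. f x - approximant (\<Xi> N) \<phi> N (intensity f (g N)) (g N) x)
      \<le> D' * sqrt (measure lebesgue \<Omega>) * 2 powr (- real N * min 1 (\<sigma> - s) / 2)" if N: "N \<ge> 1" for N
  proof -
    have rate: "2 powr (- real N * \<alpha>) \<le> 2 powr (- real N * min 1 (\<sigma> - s) / 2)"
      using \<alpha>(1) by (simp add: \<alpha>_def)
    \<comment> \<open>The translates are known to sum to one only over the box; the part of \<Omega>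
      outside it is negligible by assumption.\<close>
    have "AE x in lebesgue. x \<notin> \<Omega> - cbox (L_min \<Omega>) (L_max \<Omega>)"
      using assms(4) by (intro AE_not_in) (simp add: negligible_iff_null_sets)
    then have ae: "AE x in lebesgue. x \<in> \<Omega> \<longrightarrow> cmod (f x
        - approximant (\<Xi> N) \<phi> N (intensity f (g N)) (g N) x) \<le> D' * 2 powr (- real N * min 1 (\<sigma>
            - s) / 2)"
    proof eventually_elim
      case (elim x)
      show ?case
      proof
        assume "x \<in> \<Omega>"
        with elim have "x \<in> cbox (L_min \<Omega>) (L_max \<Omega>)"
          by blast
        from pointwise[OF N this]
        have "cmod (f x - approximant (\<Xi> N) \<phi> N (intensity f (g N)) (g N) x)
            \<le> D * 2 powr (- real N * \<alpha>)" .
        also have "\<dots> \<le> D' * 2 powr (- real N * min 1 (\<sigma> - s) / 2)"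
          using rate by (intro mult_mono) (auto simp: D'_def)
        finally show "cmod (f x - approximant (\<Xi> N) \<phi> N (intensity f (g N)) (g N) x)
            \<le> D' * 2 powr (- real N * min 1 (\<sigma> - s) / 2)" .
      qed
    qed
    have "0 \<le> D' * 2 powr (- real N * min 1 (\<sigma> - s) / 2)"
      by (simp add: D'_def)
    from L2_norm_on_le[OF assms(1,2) this ae] show ?thesis
      by (simp only: mult_ac)
  qed
  moreover have "L2_norm_on \<Omega> h \<ge> 0" for h :: "real ^ 'n \<Rightarrow> complex"
    unfolding L2_norm_on_def set_lebesgue_integral_def
        by (intro real_sqrt_ge_zero integral_nonneg_AE) auto
  ultimately show ?thesis
    by (intro bigoI[where c = "D' * sqrt (measure lebesgue \<Omega>)"] eventually_mono[OF
        eventually_ge_at_top[of 1]]) auto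
qed

end
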